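(* Let $k\ge 1$ and let $s$ be an integer with $0\le s\le k$. Then \[GR_k((k-s)P_3,\,s\widehat{K}_4)=\begin{cases}2\cdot 5^{s/2}+1, & \text{if } s \text{ is even and } s<k,\\ 2\cdot 5^{s/2}, & \text{if } s \text{ is even and } s=k,\\ 4\cdot 5^{(s-1)/2}+1, & \text{if } s \text{ is odd}.\end{cases}\]
   Context: All graphs are finite, simple and undirected. $K_n$ and $P_n$ denote the complete graph and the path on $n$ vertices. The kipas $\widehat{K}_4$ is the graph on $5$ vertices obtained from the join of $K_1$ and $P_4$ (a single vertex joined to all four vertices of a path $P_4$); equivalently, the wheel on $5$ vertices with one rim edge deleted. A Gallai $k$-coloring of $K_n$ is a map $c:E(K_n)\to\{1,\dots,k\}$ (not necessarily surjective) such that there is no rainbow triangle, i.e. no triangle whose three edges have pairwise different colors. A copy of $H$ means a (not necessarily induced) subgraph isomorphic to $H$. $GR_k((k-s)P_3,\,s\widehat{K}_4)$ denotes the minimum integer $n$ such that every Gallai $k$-coloring of $K_n$ contains a copy of $\widehat{K}_4$ with all edges of color $i$ for some $i\in\{1,\dots,s\}$, or a copy of $P_3$ with all edges of color $j$ for some $j\in\{s+1,\dots,k\}$. *)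

theory Defs
  imports "HOL-Library.FuncSet"
begin

type_synonym 'a graph = "'a set \<times> 'a set set"

abbreviation verts :: "'a graph \<Rightarrow> 'a set" where "verts \<equiv> fst"
abbreviation edges :: "'a graph \<Rightarrow> 'a set set" where "edges \<equiv> snd"

definition simple_graph :: "'a graph \<Rightarrow> bool" where
  "simple_graph G \<longleftrightarrow> finite (verts G) \<and> (\<forall>e\<in>edges G. e \<subseteq> verts G \<and> card e = 2)"

definition subgraph :: "'a graph \<Rightarrow> 'a graph \<Rightarrow> bool" where
  "subgraph S G \<longleftrightarrow> simple_graph S \<and> verts S \<subseteq> verts G \<and> edges S \<subseteq> edges G"

definition graph_iso :: "'a graph \<Rightarrow> 'b graph \<Rightarrow> bool" where
  "graph_iso G H \<longleftrightarrow>
     (\<exists>f. bij_betw f (verts G) (verts H) \<and>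
          (\<forall>u\<in>verts G. \<forall>v\<in>verts G. {u, v} \<in> edges G \<longleftrightarrow> {f u, f v} \<in> edges H))"

definition complete_graph :: "nat \<Rightarrow> nat graph" where
  "complete_graph n = ({..<n}, {e. e \<subseteq> {..<n} \<and> card e = 2})"

definition path_graph :: "nat \<Rightarrow> nat graph" where
  "path_graph n = ({..<n}, {{i, Suc i} | i. Suc i < n})"

definition join_graph :: "'a graph \<Rightarrow> 'b graph \<Rightarrow> ('a + 'b) graph" where
  "join_graph G H =
     (verts G <+> verts H,
      (\<lambda>e. Inl ` e) ` edges G \<union> (\<lambda>e. Inr ` e) ` edges H \<union>
      {{Inl u, Inr v} | u v. u \<in> verts G \<and> v \<in> verts H})"

definition kipas4 :: "(nat + nat) graph" where
  "kipas4 = join_graph (complete_graph 1) (path_graph 4)"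

text \<open>Colorings are total functions on sets of vertices; only their values on the edges
  of the complete graph matter.\<close>

definition gallai_coloring :: "nat \<Rightarrow> nat \<Rightarrow> (nat set \<Rightarrow> nat) \<Rightarrow> bool" where
  "gallai_coloring k n c \<longleftrightarrow>
     c \<in> edges (complete_graph n) \<rightarrow> {1..k} \<and>
     \<not> (\<exists>x\<in>verts (complete_graph n). \<exists>y\<in>verts (complete_graph n). \<exists>z\<in>verts (complete_graph n).
          x \<noteq> y \<and> y \<noteq> z \<and> x \<noteq> z \<and>
          c {x, y} \<noteq> c {y, z} \<and> c {y, z} \<noteq> c {x, z} \<and> c {x, y} \<noteq> c {x, z})"

definition mono_copy :: "nat \<Rightarrow> (nat set \<Rightarrow> nat) \<Rightarrow> nat \<Rightarrow> 'b graph \<Rightarrow> bool" where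
  "mono_copy n c i H \<longleftrightarrow>
     (\<exists>S. subgraph S (complete_graph n) \<and> graph_iso S H \<and> (\<forall>e\<in>edges S. c e = i))"

text \<open>The infimum of a nonempty set of naturals is its minimum. Since \<open>Inf {} = 0\<close>, the
  equation \<open>GR k s = m\<close> with \<open>m > 0\<close> also says that the set is nonempty, so that \<open>m\<close> is
  really attained as a minimum.\<close>

definition GR :: "nat \<Rightarrow> nat \<Rightarrow> nat" where
  "GR k s = Inf {n. \<forall>c. gallai_coloring k n c \<longrightarrow>
       (\<exists>i\<in>{1..s}. mono_copy n c i kipas4) \<or>
       (\<exists>j\<in>{s+1..k}. mono_copy n c j (path_graph 3))}"

end

theory Submission
  imports Defs "HOL-Library.Disjoint_Sets"
begin

text \<open>
  Put \<open>g n = 5^(n/2)\<close> for even and \<open>g n = 2 * 5^((n-1)/2)\<close> for odd \<open>n\<close>. If \<open>s\<close> colours avoid the kipas,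
  \<open>t\<close> colours avoid a path on 4 vertices and all other colours one on 3 vertices, then there are at
  most \<open>(t + 2) * g s\<close> vertices, by induction on the number of vertices. By Gallai's theorem the
  coloring is either a join of two sets in one colour, or it has a homogeneous partition whose
  parts are joined in two colours that are both connected and co-connected; these colours contain a
  path on 4 vertices, so they are kipas colours. A largest part \<open>X\<close> of size at least 2 has at most
  \<open>2 |X|\<close> neighbours in each of the two colours, which gives \<open>5 |X|\<close> vertices and the recursion
  \<open>g (n + 2) = 5 * g n\<close>; if all parts are singletons, the Ramsey number of the kipas
  bounds the number of vertices by 9.
  If all colours are kipas colours and \<open>s\<close> is even, equality would force \<open>X\<close> and its neighbouring
  parts to have the extremal size for \<open>s - 2\<close> colours, so that each of them contains an edge in one
  of the two colours. But the two parts joined to \<open>X\<close> in the colour of such an edge of \<open>X\<close> cannot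
  contain it again, and they are joined to each other in the other colour, which cannot lie inside both.
  The bounds are attained by iterated substitution into the 2-coloring of a complete graph
  on 5 vertices by a pentagon and a pentagram.
\<close>

subsection \<open>Forbidden monochromatic subgraphs\<close>

text \<open>The summand 2 in \<open>t + 2\<close> is the case of matchings alone: three vertices
  would give a rainbow triangle or two adjacent edges of one colour. Colours without a path on 4
  vertices enter because a part \<open>X\<close> with a single red neighbour may still contain a red
  path on 3 vertices. Then \<open>X\<close> is only excluded from containing longer red paths, but
  there are at most \<open>3 |X| + 1\<close> vertices in all, and
  \<open>3 (t + 3) g + 1 \<le> 5 (t + 2) g\<close>, with equality for \<open>t = 0\<close>,
  \<open>g = 1\<close>. In the same way the Ramsey bound 9 stays below \<open>2 * 5\<close>. The
  parity of \<open>s\<close> decides where the extremal colorings start. For odd \<open>s\<close> it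
  is a monochromatic complete graph on 4 vertices, which uses only a kipas colour. For even
  \<open>s\<close> it is a single edge, whose colour cannot be a kipas colour; if there is no other
  colour, one vertex is lost. The loss does not multiply by 5 under substitution, because parts may
  reuse the colours of the pentagon and the pentagram as matchings. Independent sets of a 5-cycle
  have at most two vertices, so this works in four of the five positions, and only the fifth part
  carries the deficit.\<close>

definition kipas_free :: "('a \<Rightarrow> 'a \<Rightarrow> 'b) \<Rightarrow> 'a set \<Rightarrow> 'b \<Rightarrow> bool" where
  "kipas_free c V i \<longleftrightarrow> \<not> (\<exists>v x y z w. {v, x, y, z, w} \<subseteq> V \<and> distinct [v, x, y, z, w] \<and>
     c v x = i \<and> c v y = i \<and> c v z = i \<and> c v w = i \<and> c x y = i \<and> c y z = i \<and> c z w = i)"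

definition P4_free :: "('a \<Rightarrow> 'a \<Rightarrow> 'b) \<Rightarrow> 'a set \<Rightarrow> 'b \<Rightarrow> bool" where
  "P4_free c V i \<longleftrightarrow> \<not> (\<exists>x y z w. {x, y, z, w} \<subseteq> V \<and> distinct [x, y, z, w] \<and>
     c x y = i \<and> c y z = i \<and> c z w = i)"

definition P3_free :: "('a \<Rightarrow> 'a \<Rightarrow> 'b) \<Rightarrow> 'a set \<Rightarrow> 'b \<Rightarrow> bool" where
  "P3_free c V i \<longleftrightarrow> \<not> (\<exists>x y z. {x, y, z} \<subseteq> V \<and> distinct [x, y, z] \<and> c x y = i \<and> c y z = i)"

definition rainbow_free :: "('a \<Rightarrow> 'a \<Rightarrow> 'b) \<Rightarrow> 'a set \<Rightarrow> bool" where
  "rainbow_free c V \<longleftrightarrow> (\<forall>x\<in>V. \<forall>y\<in>V. \<forall>z\<in>V. distinct [x, y, z] \<longrightarrow>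
     c x y = c y z \<or> c y z = c x z \<or> c x y = c x z)"

lemma kipas_freeD:
  assumes "kipas_free c V i" "v \<in> V" "x \<in> V" "y \<in> V" "z \<in> V" "w \<in> V" "distinct [v, x, y, z, w]"
    "c v x = i" "c v y = i" "c v z = i" "c v w = i" "c x y = i" "c y z = i" "c z w = i"
  shows False
  using assms unfolding kipas_free_def by blast

lemma P4_freeD:
  assumes "P4_free c V i" "x \<in> V" "y \<in> V" "z \<in> V" "w \<in> V" "distinct [x, y, z, w]"
    "c x y = i" "c y z = i" "c z w = i"
  shows False
  using assms unfolding P4_free_def by blast

lemma P3_freeD:
  assumes "P3_free c V i" "x \<in> V" "y \<in> V" "z \<in> V" "distinct [x, y, z]" "c x y = i" "c y z = i"
  shows False
  using assms unfolding P3_free_def by blast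

lemma rainbow_freeD:
  assumes "rainbow_free c V" "x \<in> V" "y \<in> V" "z \<in> V" "distinct [x, y, z]"
  shows "c x y = c y z \<or> c y z = c x z \<or> c x y = c x z"
  using assms unfolding rainbow_free_def by blast

lemma obtain_distinct_list:
  assumes "n \<le> card V"
  obtains xs where "length xs = n" "distinct xs" "set xs \<subseteq> V"
proof -
  obtain T where T: "T \<subseteq> V" "card T = n" "finite T"
    using obtain_subset_with_card_n[OF assms] by blast
  obtain xs where "set xs = T" "distinct xs"
    using finite_distinct_list[OF T(3)] by blast
  then show ?thesis
    using that T distinct_card by metis
qed

lemma obtain2:
  assumes "2 \<le> card V"
  obtains x y where "x \<in> V" "y \<in> V" "x \<noteq> y"
  by (rule obtain_distinct_list[OF assms]) (auto simp: length_Suc_conv numeral_2_eq_2)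

lemma obtain3:
  assumes "3 \<le> card V"
  obtains x y z where "x \<in> V" "y \<in> V" "z \<in> V" "distinct [x, y, z]"
  by (rule obtain_distinct_list[OF assms]) (auto simp: length_Suc_conv numeral_3_eq_3)

lemma obtain5:
  assumes "5 \<le> card V"
  obtains v x y z w where "v \<in> V" "x \<in> V" "y \<in> V" "z \<in> V" "w \<in> V" "distinct [v, x, y, z, w]"
  by (rule obtain_distinct_list[OF assms]) (auto simp: length_Suc_conv numeral_eq_Suc)

subsection \<open>The Ramsey number of the kipas is at most 10\<close>

text \<open>On five vertices \<open>r\<close> misses at most a matching. If \<open>p\<close>,
  \<open>q\<close> is an edge of colour \<open>b\<close>, both are joined in \<open>r\<close> to the
  other three vertices, one of which is joined in \<open>r\<close> to the remaining two; without
  such an edge everything has colour \<open>r\<close>.\<close>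

lemma kipas_in_matching_complement:
  assumes sym: "\<And>x y. c x y = c y x"
    and two: "\<And>x y. x \<in> U \<Longrightarrow> y \<in> U \<Longrightarrow> x \<noteq> y \<Longrightarrow> c x y = r \<or> c x y = b"
    and "5 \<le> card U" "kipas_free c U r" "P3_free c U b"
  shows False
proof -
  have M: "c x y = r \<or> c y z = r" if "x \<in> U" "y \<in> U" "z \<in> U" "distinct [x, y, z]" for x y z
    using P3_freeD[OF assms(5), of x y z] two[of x y] two[of y z] that by auto
  obtain x1 x2 x3 x4 x5 where x: "x1 \<in> U" "x2 \<in> U" "x3 \<in> U" "x4 \<in> U" "x5 \<in> U"
      "distinct [x1, x2, x3, x4, x5]"
    using obtain5[OF assms(3)] by metis
  have *: False if "c p q \<noteq> r" and V: "p \<in> U" "q \<in> U" "u \<in> U" "v \<in> U" "w \<in> U"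
    and D: "distinct [p, q, u, v, w]" for p q u v w
  proof -
    have pq: "c p y = r \<and> c q y = r" if "y \<in> {u, v, w}" for y
      using M[of y p q] M[of p q y] \<open>c p q \<noteq> r\<close> that V D sym by auto
    have K: False if "c x y = r" "c x z = r" "{x, y, z} = {u, v, w}" "distinct [x, y, z]" for x y z
    proof -
      have "x \<in> {u, v, w}" "y \<in> {u, v, w}" "z \<in> {u, v, w}"
        using that(3) by blast+
      \<comment> \<open>The kipas has centre \<open>x\<close> and path \<open>p\<close>,
        \<open>y\<close>, \<open>q\<close>, \<open>z\<close>.\<close>
      then show False
        using kipas_freeD[OF assms(4), of x p y q z] pq V D that(1,2,4) sym by auto
    qed
    consider "c u v = r" "c u w = r" | "c v u = r" "c v w = r" | "c w u = r" "c w v = r"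
      using M[of u v w] M[of v w u] M[of w u v] V D sym by auto
    then show False
      using K[of u v w] K[of v u w] K[of w u v] D by cases auto
  qed
  have "c x1 x2 = r" using *[of x1 x2 x3 x4 x5] x by auto
  moreover have "c x1 x3 = r" using *[of x1 x3 x2 x4 x5] x by auto
  moreover have "c x1 x4 = r" using *[of x1 x4 x2 x3 x5] x by auto
  moreover have "c x1 x5 = r" using *[of x1 x5 x2 x3 x4] x by auto
  moreover have "c x2 x3 = r" using *[of x2 x3 x1 x4 x5] x by auto
  moreover have "c x3 x4 = r" using *[of x3 x4 x1 x2 x5] x by auto
  moreover have "c x4 x5 = r" using *[of x4 x5 x1 x2 x3] x by auto
  ultimately show False
    using kipas_freeD[OF assms(4), of x1 x2 x3 x4 x5] x by auto
qed

lemma doubleton_partner: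
  assumes "p \<in> {x, y}"
  obtains q where "{p, q} = {x, y}"
  using assms by (cases "p = x") (auto simp: insert_commute)

locale two_coloring =
  fixes c :: "'a \<Rightarrow> 'a \<Rightarrow> 'b" and V :: "'a set" and r b :: 'b
  assumes sym: "c x y = c y x"
    and finite: "finite V"
    and rb: "r \<noteq> b"
    and two: "x \<in> V \<Longrightarrow> y \<in> V \<Longrightarrow> x \<noteq> y \<Longrightarrow> c x y = r \<or> c x y = b"
    and kr: "kipas_free c V r"
    and kb: "kipas_free c V b"
begin

lemma swap: "two_coloring c V b r"
  using two rb finite kr kb sym by unfold_locales auto

text \<open>A vertex outside a red complete graph on 4 vertices sends at most one red edge into it,
  since two would give a red kipas. So the outside vertices have many common blue neighbours in it,
  which makes blue a matching on the at least \<open>9 - 4 = 5\<close> outside vertices.\<close>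

lemma no_K4:
  assumes "9 \<le> card V" "{p, q, s, t} \<subseteq> V" "distinct [p, q, s, t]"
    and K: "c p q = r" "c p s = r" "c p t = r" "c q s = r" "c q t = r" "c s t = r"
  shows False
proof -
  let ?S = "{p, q, s, t}"
  define U where "U = V - ?S"
  have cS: "card ?S = 4" using assms(3) by simp
  have "card U = card V - 4"
    unfolding U_def using card_Diff_subset[of ?S V] assms(2) cS by simp
  then have U5: "5 \<le> card U" using assms(1) by simp
  have SK: "c x y = r" if "x \<in> ?S" "y \<in> ?S" "x \<noteq> y" for x y
    using that K sym[of x y] by auto
  have one: "x = y" if "u \<in> U" "x \<in> ?S" "y \<in> ?S" "c u x = r" "c u y = r" for u x y
  proof (rule ccontr)
    assume "x \<noteq> y"
    then have "card (?S - {x, y}) = 2"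
      using that(2,3) cS by (subst card_Diff_subset) auto
    then obtain z w where zw: "z \<in> ?S - {x, y}" "w \<in> ?S - {x, y}" "z \<noteq> w"
      using obtain2[of "?S - {x, y}"] by (metis order_refl)
    have "u \<notin> ?S" "u \<in> V" using that(1) U_def by auto
    moreover have "x \<in> V" "y \<in> V" "z \<in> V" "w \<in> V" using that(2,3) zw assms(2) by blast+
    moreover have "distinct [x, u, y, z, w]" using \<open>x \<noteq> y\<close> \<open>u \<notin> ?S\<close> zw that(2,3) by auto
    moreover have "c x y = r" "c x z = r" "c x w = r" "c y z = r" "c z w = r"
      using SK that(2,3) zw \<open>x \<noteq> y\<close> by blast+
    ultimately show False
      using kipas_freeD[OF kr, of x u y z w] sym that(4,5) by auto
  qed
  have ex: "\<exists>e. \<forall>x\<in>?S. x \<noteq> e \<longrightarrow> c u x = b" if u: "u \<in> U" for u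
  proof -
    have "u \<in> V" "u \<notin> ?S" using u U_def by auto
    then have tw: "c u x = r \<or> c u x = b" if "x \<in> ?S" for x
      using two[of u x] assms(2) that by auto
    show ?thesis
    proof (cases "\<exists>e\<in>?S. c u e = r")
      case True
      then obtain e where "e \<in> ?S" "c u e = r" by blast
      then have "\<forall>x\<in>?S. x \<noteq> e \<longrightarrow> c u x = b" using one[OF u] tw by metis
      then show ?thesis ..
    next
      case False
      then have "\<forall>x\<in>?S. c u x = b" using tw by metis
      then show ?thesis by simp
    qed
  qed
  have P3: "P3_free c U b"
    unfolding P3_free_def
  proof (rule notI, elim exE conjE)
    fix y x z
    assume A: "{y, x, z} \<subseteq> U" "distinct [y, x, z]" "c y x = b" "c x z = b"
    obtain ex where e1: "\<forall>p\<in>?S. p \<noteq> ex \<longrightarrow> c x p = b" using ex A by blast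
    obtain ey where e2: "\<forall>p\<in>?S. p \<noteq> ey \<longrightarrow> c y p = b" using ex A by blast
    obtain ez where e3: "\<forall>p\<in>?S. p \<noteq> ez \<longrightarrow> c z p = b" using ex A by blast
    have pick: "\<exists>f\<in>?S. f \<notin> {e, e', e''}" for e e' e''
    proof (rule ccontr)
      assume "\<not> ?thesis"
      then have "?S \<subseteq> {e, e', e''}" by blast
      then have "card ?S \<le> card {e, e', e''}" by (rule card_mono[rotated]) simp
      moreover have "card {e, e', e''} \<le> 3" by (simp add: card_insert_if)
      ultimately show False using cS by linarith
    qed
    \<comment> \<open>The exceptions of \<open>x\<close>, \<open>y\<close>, \<open>z\<close> exclude
      at most three of the four vertices, so \<open>f\<close> is blue to all of them;
      \<open>g\<close> only has to be blue to \<open>x\<close> and \<open>y\<close>. The kipas has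
      centre \<open>x\<close> and path \<open>g\<close>, \<open>y\<close>, \<open>f\<close>,
      \<open>z\<close>.\<close>
    obtain f where f: "f \<in> ?S" "f \<notin> {ex, ey, ez}" using pick by blast
    obtain g where g: "g \<in> ?S" "g \<notin> {ex, ey, f}" using pick by blast
    have "x \<in> V" "y \<in> V" "z \<in> V" "x \<notin> ?S" "y \<notin> ?S" "z \<notin> ?S" using A(1) U_def by auto
    moreover have "f \<in> V" "g \<in> V" using f g assms(2) by blast+
    moreover have "c x f = b" "c x g = b" "c y f = b" "c y g = b" "c z f = b"
      using e1 e2 e3 f g by blast+
    moreover have "distinct [x, g, y, f, z]"
      using A(2) f(1) g \<open>x \<notin> ?S\<close> \<open>y \<notin> ?S\<close> \<open>z \<notin> ?S\<close> by auto
    ultimately show False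
      using kipas_freeD[OF kb, of x g y f z] A(3,4) sym by auto
  qed
  have kU: "kipas_free c U r"
    using kr unfolding kipas_free_def U_def by blast
  have "c x y = r \<or> c x y = b" if "x \<in> U" "y \<in> U" "x \<noteq> y" for x y
    using two[of x y] that U_def by auto
  then show False
    by (rule kipas_in_matching_complement[of c U r b, OF sym _ U5 kU P3])
qed

definition nbr :: "'a \<Rightarrow> 'a set" where
  "nbr v = {x \<in> V. x \<noteq> v \<and> c v x = r}"

end

locale large_two_coloring = two_coloring +
  assumes large: "9 \<le> card V"
begin

lemma swap': "large_two_coloring c V b r"
  using swap large by (simp add: large_two_coloring_def large_two_coloring_axioms_def)

lemmas no_K4_blue = two_coloring.no_K4[OF swap large]

lemma nbr_no_triangle:
  assumes "v \<in> V" "x \<in> nbr v" "y \<in> nbr v" "z \<in> nbr v" "distinct [x, y, z]"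
    "c x y = r" "c y z = r"
  shows "c x z = b"
  using no_K4[OF large, of v x y z] assms two[of x z] unfolding nbr_def by auto

lemma nbr_no_P4:
  assumes "v \<in> V" "x \<in> nbr v" "y \<in> nbr v" "z \<in> nbr v" "w \<in> nbr v" "distinct [x, y, z, w]"
    "c x y = r" "c y z = r" "c z w = r"
  shows False
  using kipas_freeD[OF kr, of v x y z w] assms unfolding nbr_def by auto

text \<open>In a red neighbourhood red has neither a triangle nor a path on 4 vertices, so the ends
  of the red path \<open>x\<close>, \<open>y\<close>, \<open>z\<close> have no other red edges to
  these vertices. Then \<open>d\<close>, \<open>e\<close> is red, or \<open>x\<close>,
  \<open>z\<close>, \<open>d\<close>, \<open>e\<close> would be a blue complete graph; and a red
  edge \<open>d\<close>, \<open>y\<close> would extend to the path \<open>e\<close>,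
  \<open>d\<close>, \<open>y\<close>, \<open>x\<close>.\<close>

lemma nbr_cherry:
  assumes v: "v \<in> V" and N: "x \<in> nbr v" "y \<in> nbr v" "z \<in> nbr v" "d \<in> nbr v" "e \<in> nbr v"
    and D: "distinct [x, y, z, d, e]" and "c y x = r" "c y z = r"
  shows "c x z = b" "c d x = b" "c d y = b" "c d z = b" "c d e = r"
proof -
  show xz: "c x z = b" using nbr_no_triangle[OF v N(1-3)] assms sym by auto
  have V: "x \<in> V" "y \<in> V" "z \<in> V" "d \<in> V" "e \<in> V" using N nbr_def by auto
  have x: "c u x = b" "c u z = b" if "u \<in> {d, e}" for u
    using nbr_no_P4[OF v, of u x y z] nbr_no_P4[OF v, of u z y x] two[of u x] two[of u z] that V N assms(8,9) D sym
    by auto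
  then show "c d x = b" "c d z = b" by auto
  show de: "c d e = r"
    using no_K4_blue[of x z d e] xz x[of d] x[of e] V D two[of d e] sym by auto
  show "c d y = b"
    using nbr_no_P4[OF v, of e d y x] de V N D assms(8) two[of d y] sym by auto
qed

text \<open>Red is not a matching on five vertices, as this would force a blue kipas. So there is a
  red path on 3 vertices, and by \<open>nbr_cherry\<close> all remaining vertices are pairwise red;
  three of them would form a red triangle.\<close>

lemma nbr_structure:
  assumes v: "v \<in> V" and "5 \<le> card (nbr v)"
  obtains x y z d e where "nbr v = {x, y, z, d, e}" "distinct [x, y, z, d, e]" "c y x = r" "c y z = r"
proof -
  have "\<not> P3_free c (nbr v) r"
  proof
    assume P3: "P3_free c (nbr v) r"
    have K: "kipas_free c (nbr v) b" using kb unfolding kipas_free_def nbr_def by blast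
    have "c x y = b \<or> c x y = r" if "x \<in> nbr v" "y \<in> nbr v" "x \<noteq> y" for x y
      using two[of x y] that nbr_def by auto
    then show False
      by (rule kipas_in_matching_complement[of c "nbr v" b r, OF sym _ assms(2) K P3])
  qed
  then obtain x y z where xyz: "x \<in> nbr v" "y \<in> nbr v" "z \<in> nbr v" "distinct [x, y, z]"
    "c y x = r" "c y z = r"
    unfolding P3_free_def using sym by auto
  let ?R = "nbr v - {x, y, z}"
  have "card ?R \<ge> 2"
    using assms(2) xyz by (subst card_Diff_subset) auto
  then obtain d e where de: "d \<in> ?R" "e \<in> ?R" "d \<noteq> e" by (rule obtain2)
  have "nbr v = {x, y, z, d, e}"
  proof (rule ccontr)
    assume "nbr v \<noteq> {x, y, z, d, e}"
    then obtain f where f: "f \<in> nbr v" "f \<notin> {x, y, z, d, e}" using xyz de by blast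
    have "c d e = r" "c d f = r" "c e f = r"
      using nbr_cherry(5)[OF v xyz(1-3), of d e] nbr_cherry(5)[OF v xyz(1-3), of d f]
        nbr_cherry(5)[OF v xyz(1-3), of e f] xyz de f by auto
    then show False
      using nbr_no_triangle[OF v, of d e f] de f rb by auto
  qed
  then show ?thesis using that xyz de by auto
qed

text \<open>The colour-swapped \<open>nbr_cherry\<close>, with the blue neighbourhood spelled out so
  that it can be applied where only the red one has a name.\<close>

lemma nbr_cherry_blue:
  assumes "v \<in> V" "{x, y, z, d, e} \<subseteq> V" "distinct [v, x, y, z, d, e]"
    "c v x = b" "c v y = b" "c v z = b" "c v d = b" "c v e = b" "c y x = b" "c y z = b"
  shows "c x z = r" "c d x = r" "c d y = r" "c d z = r" "c d e = b"
proof -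
  interpret sw: large_two_coloring c V b r by (rule swap')
  have "x \<in> sw.nbr v" "y \<in> sw.nbr v" "z \<in> sw.nbr v" "d \<in> sw.nbr v" "e \<in> sw.nbr v"
    using assms unfolding sw.nbr_def by auto
  with sw.nbr_cherry[OF assms(1), of x y z d e] assms
  show "c x z = r" "c d x = r" "c d y = r" "c d z = r" "c d e = b" by auto
qed

text \<open>The red neighbourhood is a red path \<open>l\<close>, \<open>m\<close>,
  \<open>l'\<close> and a red edge \<open>d\<close>, \<open>e\<close>, with blue in between. Each of
  the at least four vertices outside is red to both \<open>l\<close> and \<open>l'\<close> or to
  both \<open>d\<close> and \<open>e\<close>. Two vertices of the latter kind are contradictory, and
  so are three that are not of this kind.\<close>

lemma large_degree:
  assumes v: "v \<in> V" and "10 \<le> card V" and deg: "5 \<le> card (nbr v)"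
  shows False
proof -
  obtain l m l' d e where N: "nbr v = {l, m, l', d, e}" "distinct [l, m, l', d, e]" "c m l = r" "c m l' = r"
    using nbr_structure[OF v deg] by metis
  have inN: "l \<in> nbr v" "m \<in> nbr v" "l' \<in> nbr v" "d \<in> nbr v" "e \<in> nbr v" using N by auto
  note ch = nbr_cherry[OF v inN N(2-4)] nbr_cherry[OF v inN(1-3) inN(5) inN(4), simplified]
  have inV: "l \<in> V" "m \<in> V" "l' \<in> V" "d \<in> V" "e \<in> V" and cv: "c v l = r" "c v m = r" "c v l' = r" "c v d = r" "c v e = r"
    and nv: "v \<notin> {l, m, l', d, e}"
    using inN unfolding nbr_def by auto
  have ll: "c l l' = b" and dl: "c d l = b" "c d l' = b" "c d m = b" "c d e = r"
    "c e l = b" "c e l' = b" "c e m = b"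
    using ch N by auto
  define W where "W = V - insert v (nbr v)"
  have "card (insert v (nbr v)) = 6" using N nv by auto
  moreover have "insert v (nbr v) \<subseteq> V" using v nbr_def by auto
  ultimately have "card W = card V - 6"
    unfolding W_def using finite card_Diff_subset[of "insert v (nbr v)" V] finite_subset by metis
  then have W4: "4 \<le> card W" using assms(2) by simp
  have WV: "x \<in> V" "x \<notin> {v, l, m, l', d, e}" "c v x = b" if "x \<in> W" for x
  proof -
    have x: "x \<in> V" "x \<noteq> v" "x \<notin> nbr v" using that W_def by auto
    then show "x \<in> V" "x \<notin> {v, l, m, l', d, e}" using N(1) by auto
    show "c v x = b" using two[OF v, of x] x nbr_def by auto
  qed
  \<comment> \<open>Otherwise there is a blue kipas with centre \<open>p\<close> and path
    \<open>x\<close>, \<open>q\<close>, \<open>p'\<close>, \<open>q'\<close>.\<close>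
  have S1: "(c x l = r \<and> c x l' = r) \<or> (c x d = r \<and> c x e = r)" if x: "x \<in> W" for x
  proof -
    have "\<not> (c x p = b \<and> c x q = b)" if pl: "p \<in> {l, l'}" and qd: "q \<in> {d, e}" for p q
    proof
      assume A: "c x p = b \<and> c x q = b"
      obtain p' where p: "{p, p'} = {l, l'}" using doubleton_partner[OF pl] .
      obtain q' where q: "{q, q'} = {d, e}" using doubleton_partner[OF qd] .
      note p' = p q
      have "c p p' = b" "c q p = b" "c q p' = b" "c q' p = b" "c q' p' = b"
        using p' ll dl sym[of l l'] sym[of d l] sym[of d l'] sym[of e l] sym[of e l']
        unfolding doubleton_eq_iff by (elim disjE conjE; simp)+
      moreover have "distinct [p, x, q, p', q']" "p \<in> V" "p' \<in> V" "q \<in> V" "q' \<in> V"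
        using p' WV(2)[OF x] N(2) inV by (auto simp: doubleton_eq_iff)
      ultimately show False
        using kipas_freeD[OF kb, of p x q p' q'] WV(1)[OF x] A sym by auto
    qed
    then show ?thesis
      using two[of x l] two[of x l'] two[of x d] two[of x e] WV[OF x] inV by auto
  qed
  \<comment> \<open>Otherwise there is a red kipas with centre \<open>m\<close> and path
    \<open>x\<close>, \<open>l\<close>, \<open>v\<close>, \<open>l'\<close>.\<close>
  have S2: "c x m = b" if x: "x \<in> W" and xl: "c x l = r" "c x l' = r" for x
    using kipas_freeD[OF kr, of m x l v l'] WV[OF x] inV cv nv N v xl two[of x m] sym by auto
  \<comment> \<open>If \<open>x\<close> were red to \<open>p\<close>, the red neighbourhood of
    \<open>p\<close> would contain the red path \<open>y\<close>, \<open>q\<close>,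
    \<open>y'\<close> together with \<open>v\<close> and \<open>x\<close>, and
    \<open>nbr_cherry\<close> would make \<open>v\<close>, \<open>q\<close> blue.\<close>
  have S3: "c x d = b \<and> c x e = b" if x: "x \<in> W" and y: "y \<in> W" "y' \<in> W" "distinct [x, y, y']"
    "c y d = r" "c y e = r" "c y' d = r" "c y' e = r" for x y y'
  proof -
    have "c x p = b" if pq: "{p, q} = {d, e}" for p q
    proof (rule ccontr)
      have pq': "p \<in> V" "q \<in> V" "p \<noteq> q" "c p q = r" "c v p = r" "c v q = r"
        "c y p = r" "c y q = r" "c y' p = r" "c y' q = r"
        using pq inV dl cv y N(2) sym[of d e] by (auto simp: doubleton_eq_iff)
      assume "c x p \<noteq> b"
      moreover have "p \<noteq> x" using WV[OF x] pq by auto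
      ultimately have "c x p = r" using two[of x p] WV[OF x] pq' by auto
      then have "y \<in> nbr p" "q \<in> nbr p" "y' \<in> nbr p" "v \<in> nbr p" "x \<in> nbr p"
        "distinct [y, q, y', v, x]"
        unfolding nbr_def using pq' pq v WV[OF x] WV[OF y(1)] WV[OF y(2)] y(3) inV nv sym by auto
      then show False
        using nbr_cherry(3)[of p y q y' v x] pq' rb sym by auto
    qed
    from this[of d e] this[of e d] show ?thesis by auto
  qed
  define X where "X = {x \<in> W. c x d = r \<and> c x e = r}"
  have "finite W" using finite W_def by simp
  then have "finite X" using X_def by simp
  show False
  proof (cases "2 \<le> card X")
    case True
    then obtain y y' where y: "y \<in> X" "y' \<in> X" "y \<noteq> y'" by (rule obtain2)
    have "card (W - {y, y'}) \<ge> 2"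
      using W4 y X_def by (subst card_Diff_subset) auto
    then obtain x x' where x: "x \<in> W - {y, y'}" "x' \<in> W - {y, y'}" "x \<noteq> x'" by (rule obtain2)
    have de: "c x d = b \<and> c x e = b" "c x' d = b \<and> c x' e = b"
      using S3[of x y y'] S3[of x' y y'] x y X_def by auto
    then have "c x m = b" "c x' m = b" using S1[of x] S1[of x'] S2[of x] S2[of x'] x rb by auto
    \<comment> \<open>The blue kipas has centre \<open>m\<close> and path \<open>x\<close>,
      \<open>d\<close>, \<open>x'\<close>, \<open>e\<close>.\<close>
    then show False
      using kipas_freeD[OF kb, of m x d x' e] de dl x WV[of x] WV[of x'] inV N(2) sym by auto
  next
    case False
    have "card (W - X) \<ge> 3"
      using False W4 \<open>finite X\<close> X_def by (subst card_Diff_subset) auto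
    then obtain x1 x2 x3 where x: "x1 \<in> W - X" "x2 \<in> W - X" "x3 \<in> W - X" "distinct [x1, x2, x3]"
      by (rule obtain3)
    \<comment> \<open>The blue neighbourhood of \<open>m\<close> contains the blue path
      \<open>x\<close>, \<open>p\<close>, \<open>y\<close> and also \<open>z\<close>,
      \<open>q\<close>, so \<open>x\<close>, \<open>y\<close>, \<open>z\<close> is a red triangle,
      and \<open>l\<close> is red to all three.\<close>
    have no: False if "{p, q} = {d, e}" "x \<in> W - X" "y \<in> W - X" "z \<in> W - X" "distinct [x, y, z]"
      "c x p = b" "c y p = b" for p q x y z
    proof -
      have l: "c u l = r" "c u m = b" "c m u = b" "c l u = r" if "u \<in> W - X" for u
        using S1[of u] S2[of u] that X_def sym[of m u] sym[of l u] by auto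
      have pq: "c m p = b" "c m q = b" "p \<in> V" "q \<in> V" "p \<noteq> q" "m \<noteq> p" "m \<noteq> q"
        "p \<notin> W" "q \<notin> W" "m \<notin> W" "l \<notin> W"
        using that(1) dl inV N(2) sym WV by (auto simp: doubleton_eq_iff)
      have xV: "x \<in> V" "y \<in> V" "z \<in> V" using that WV by auto
      have A: "{x, p, y, z, q} \<subseteq> V" "distinct [m, x, p, y, z, q]"
        "c m x = b" "c m p = b" "c m y = b" "c m z = b" "c m q = b" "c p x = b" "c p y = b"
        using xV pq that(2-7) l(3)[OF that(2)] l(3)[OF that(3)] l(3)[OF that(4)] inV(2) sym[of p x] sym[of p y] by auto
      have "c x y = r" "c z x = r" "c z y = r"
        using nbr_cherry_blue[OF inV(2) A] by auto
      then show False
        using no_K4[OF large, of l x y z] inV xV that(2-5) pq l(4)[OF that(2)] l(4)[OF that(3)] l(4)[OF that(4)] sym by auto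
    qed
    have side: "c x d = b \<or> c x e = b" if "x \<in> W - X" for x
      using that two[of x d] two[of x e] WV[of x] inV unfolding X_def by auto
    have D: False if "c x p = b" "c y p = b" and xy: "x \<noteq> y" and "x \<in> {x1, x2, x3}" "y \<in> {x1, x2, x3}" and pd: "p \<in> {d, e}" for x y p
    proof -
      have "x1 \<notin> {x, y} \<or> x2 \<notin> {x, y} \<or> x3 \<notin> {x, y}" using x(4) by auto
      then obtain z where "z \<in> {x1, x2, x3}" "distinct [x, y, z]" using xy by auto
      moreover obtain q where "{p, q} = {d, e}"
        using doubleton_partner[OF pd] .
      ultimately show False using no[of p q x y z] that x by auto
    qed
    \<comment> \<open>Each of three vertices is blue to \<open>d\<close> or to \<open>e\<close>, so
      two of them are blue to the same one.\<close>
    show False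
      using side[OF x(1)] side[OF x(2)] side[OF x(3)] x(4)
        D[of x1 d x2] D[of x1 d x3] D[of x2 d x3] D[of x1 e x2] D[of x1 e x3] D[of x2 e x3] by auto
  qed
qed

end

text \<open>Among ten vertices each has degree 9, so one of its two colour degrees is at least
  5.\<close>

lemma (in two_coloring) card_le_9: "card V \<le> 9"
proof (rule ccontr)
  assume "\<not> card V \<le> 9"
  then have V: "10 \<le> card V" by simp
  interpret R: large_two_coloring c V r b using V by unfold_locales simp
  interpret B: large_two_coloring c V b r by (rule R.swap')
  obtain v where v: "v \<in> V" using V by fastforce
  have V_eq: "V = insert v (nbr v \<union> B.nbr v)"
    unfolding nbr_def B.nbr_def using two v by auto
  have "card V \<le> Suc (card (nbr v \<union> B.nbr v))"
    by (subst V_eq) (rule card_insert_le_m1, simp_all)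
  also have "\<dots> \<le> Suc (card (nbr v) + card (B.nbr v))"
    using card_Un_le by simp
  finally have "card V \<le> Suc (card (nbr v) + card (B.nbr v))" .
  then show False
    using R.large_degree[OF v V] B.large_degree[OF v V] V by linarith
qed

subsection \<open>Gallai partitions\<close>

definition splittable :: "('a \<Rightarrow> 'a \<Rightarrow> 'b) \<Rightarrow> 'a set \<Rightarrow> bool" where
  "splittable c V \<longleftrightarrow> (\<exists>A B i. A \<noteq> {} \<and> B \<noteq> {} \<and> A \<inter> B = {} \<and> A \<union> B = V \<and> (\<forall>x\<in>A. \<forall>y\<in>B. c x y = i))"

lemma splittableI:
  assumes "A \<subseteq> V" "A \<noteq> {}" "A \<noteq> V" "\<And>x y. x \<in> A \<Longrightarrow> y \<in> V - A \<Longrightarrow> c x y = i"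
  shows "splittable c V"
  unfolding splittable_def using assms by (intro exI[of _ A] exI[of _ "V - A"] exI[of _ i]) auto

section \<open>Connectivity of colour classes in the absence of rainbow triangles\<close>

definition reach :: "('a \<Rightarrow> 'a \<Rightarrow> 'b) \<Rightarrow> 'a set \<Rightarrow> 'b \<Rightarrow> 'a \<Rightarrow> 'a \<Rightarrow> bool" where
  "reach c V i = (\<lambda>x y. x \<in> V \<and> y \<in> V \<and> x \<noteq> y \<and> c x y = i)\<^sup>*\<^sup>*"

definition spanning :: "('a \<Rightarrow> 'a \<Rightarrow> 'b) \<Rightarrow> 'a set \<Rightarrow> 'b \<Rightarrow> bool" where
  "spanning c V i \<longleftrightarrow> (\<forall>x\<in>V. \<forall>y\<in>V. reach c V i x y)"

lemma reach_refl [simp]: "reach c V i x x"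
  by (simp add: reach_def)

lemma reach_trans: "reach c V i x y \<Longrightarrow> reach c V i y z \<Longrightarrow> reach c V i x z"
  unfolding reach_def by (rule rtranclp_trans)

lemma reach_edge: "x \<in> V \<Longrightarrow> y \<in> V \<Longrightarrow> c x y = i \<Longrightarrow> reach c V i x y"
  unfolding reach_def by (cases "x = y") auto

context
  fixes c :: "'a \<Rightarrow> 'a \<Rightarrow> 'b"
  assumes sym: "\<And>x y. c x y = c y x"
begin

lemma reach_sym: "reach c V i x y \<Longrightarrow> reach c V i y x"
  unfolding reach_def
proof (induction rule: rtranclp_induct)
  case (step y z)
  then show ?case using sym[of y z] by (intro converse_rtranclp_into_rtranclp[of _ z y]) auto
qed simp

text \<open>Along an edge of colour \<open>i\<close> in the component of \<open>u\<close>, the two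
  edges to \<open>x\<close> do not have colour \<open>i\<close>. The triangle is not rainbow, so
  they have the same colour; hence the colour seen from \<open>x\<close> is constant on the
  component.\<close>

lemma reach_homogeneous:
  assumes "rainbow_free c V" "u \<in> V" "x \<in> V" "reach c V i u w" "\<not> reach c V i u x"
  shows "c x u = c x w"
  using assms(4) unfolding reach_def
proof (induction rule: rtranclp_induct)
  case (step y z)
  then have y: "reach c V i u y" "y \<in> V" "z \<in> V" "y \<noteq> z" "c y z = i" unfolding reach_def by auto
  then have z: "reach c V i u z" using reach_trans reach_edge by metis
  have "c y x \<noteq> i" "c z x \<noteq> i" "x \<noteq> y" "x \<noteq> z"
    using assms(3,5) y z reach_trans reach_edge by metis+
  then have "c x y = c x z"
    using rainbow_freeD[OF assms(1), of x y z] assms(3) y sym[of x] by auto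
  then show ?case using step by simp
qed simp

text \<open>If deleting \<open>v\<close> disconnects \<open>i\<close>, each component of
  \<open>i\<close> in \<open>U\<close> contains a vertex joined to \<open>v\<close> in
  \<open>i\<close>. A vertex joined to \<open>v\<close> in another colour \<open>l\<close> is joined
  in \<open>l\<close> to all such vertices of the other components. Taking \<open>l = j\<close> and
  \<open>l = k\<close>, homogeneity over components forces \<open>j = k\<close>, whether the two
  vertices lie in the same component or not.\<close>

lemma three_spanning_step:
  assumes rf: "rainbow_free c (insert v U)" and v: "v \<notin> U"
    and s: "spanning c (insert v U) i" "spanning c (insert v U) j" "spanning c (insert v U) k"
    and d: "distinct [i, j, k]" and ns: "\<not> spanning c U i"
  shows False
proof -
  have rfU: "rainbow_free c U" using rf unfolding rainbow_free_def by auto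
  obtain p q where pq: "p \<in> U" "q \<in> U" "\<not> reach c U i p q" using ns spanning_def by metis
  have edge: "\<exists>u\<in>U. c v u = l" if "spanning c (insert v U) l" for l
  proof -
    have "reach c (insert v U) l v p" using that pq unfolding spanning_def by auto
    moreover have "v \<noteq> p" using v pq by auto
    ultimately show ?thesis
      unfolding reach_def by (cases rule: converse_rtranclpE) auto
  qed
  have link: "\<exists>x\<in>U. reach c U i u x \<and> c v x = i" if u: "u \<in> U" for u
  proof -
    have "(y \<in> U \<and> reach c U i u y) \<or> (\<exists>x\<in>U. reach c U i u x \<and> c v x = i)"
      if "reach c (insert v U) i u y" for y
      using that unfolding reach_def[of c "insert v U"]
    proof (induction rule: rtranclp_induct)
      case (step y z)
      show ?case
      proof (cases "\<exists>x\<in>U. reach c U i u x \<and> c v x = i")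
        case False
        then have "y \<in> U" "reach c U i u y" using step by auto
        moreover have "z \<in> U" using False step \<open>y \<in> U\<close> \<open>reach c U i u y\<close> sym[of v y] by auto
        ultimately show ?thesis using step reach_trans reach_edge by metis
      qed simp
    qed (use u in auto)
    then show ?thesis using s(1) u v unfolding spanning_def by auto
  qed
  have tri: "c x z = l" if "x \<in> U" "c v x = l" "l \<noteq> i" "z \<in> U" "\<not> reach c U i x z" "c v z = i" for x z l
  proof -
    have "c x z \<noteq> i" "x \<noteq> z" "v \<noteq> x" "v \<noteq> z" using that v reach_edge reach_refl by metis+
    then show ?thesis
      using rainbow_freeD[OF rf, of v x z] that v by auto
  qed
  obtain u where u: "u \<in> U" "c v u = j" using edge s by metis
  obtain w where w: "w \<in> U" "c v w = k" using edge s by metis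
  show False
  proof (cases "reach c U i u w")
    case True
    obtain z where z: "z \<in> U" "\<not> reach c U i u z"
      using pq reach_trans reach_sym by metis
    obtain x where x: "x \<in> U" "reach c U i z x" "c v x = i" using link[OF z(1)] by blast
    have nx: "\<not> reach c U i u x" "\<not> reach c U i w x"
      using z x True reach_trans reach_sym by metis+
    have "c u x = j" "c w x = k" using tri u w x nx d by auto
    moreover have "c x u = c x w" using reach_homogeneous[OF rfU u(1) x(1) True nx(1)] .
    ultimately show False using d sym by (metis distinct_length_2_or_more)
  next
    case False
    obtain x where x: "x \<in> U" "reach c U i w x" "c v x = i" using link[OF w(1)] by blast
    obtain y where y: "y \<in> U" "reach c U i u y" "c v y = i" using link[OF u(1)] by blast
    have n: "\<not> reach c U i u x" "\<not> reach c U i w y" "\<not> reach c U i w u"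
      using False x y reach_trans reach_sym by metis+
    have "c u x = j" "c w y = k" using tri u w x y n d by auto
    moreover have "c u w = c u x" using reach_homogeneous[OF rfU w(1) u(1) x(2) n(3)] .
    moreover have "c w u = c w y" using reach_homogeneous[OF rfU u(1) w(1) y(2) False] .
    ultimately show False using d sym[of u w] by auto
  qed
qed

text \<open>Vertices are deleted, which keeps all three colours connected by
  \<open>three_spanning_step\<close>, until a single edge is left; it has only one colour.\<close>

lemma not_three_spanning:
  assumes "finite V" "2 \<le> card V" "rainbow_free c V" "distinct [i, j, k]"
  shows "\<not> (spanning c V i \<and> spanning c V j \<and> spanning c V k)"
  using assms(1-3)
proof (induction V rule: finite_induct)
  case (insert v U)
  show ?case
  proof
    assume s: "spanning c (insert v U) i \<and> spanning c (insert v U) j \<and> spanning c (insert v U) k"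
    have rf: "rainbow_free c U" using insert.prems(2) unfolding rainbow_free_def by auto
    show False
    proof (cases "2 \<le> card U")
      case True
      then consider "\<not> spanning c U i" | "\<not> spanning c U j" | "\<not> spanning c U k"
        using insert.IH rf by blast
      then show False
        using three_spanning_step[OF insert.prems(2) insert.hyps(2), of i j k]
          three_spanning_step[OF insert.prems(2) insert.hyps(2), of j i k]
          three_spanning_step[OF insert.prems(2) insert.hyps(2), of k i j] s assms(4)
        by cases auto
    next
      case False
      then have "card U = 1" using insert by auto
      then obtain u where "U = {u}" by (auto simp: card_Suc_eq)
      have "c v u = l" if "spanning c (insert v U) l" for l
      proof -
        have "reach c (insert v U) l v u" using that \<open>U = {u}\<close> unfolding spanning_def by auto
        moreover have "v \<noteq> u" using \<open>U = {u}\<close> insert by auto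
        ultimately show ?thesis
          unfolding reach_def using \<open>U = {u}\<close> by (cases rule: converse_rtranclpE) auto
      qed
      then show False using s assms(4) by auto
    qed
  qed
qed simp

end

text \<open>Homogeneity on one side suffices as an axiom because \<open>sym\<close> gives the other
  side. The connectedness of both colours between the parts is encoded in \<open>nosplit\<close>: if
  one were disconnected there, a union of parts would be joined to the rest in the other
  colour.\<close>

locale gallai_reduced =
  fixes c :: "'a \<Rightarrow> 'a \<Rightarrow> 'b" and V :: "'a set" and P :: "'a set set" and r b :: 'b
  assumes sym: "c x y = c y x"
    and finite: "finite V"
    and partition: "partition_on V P"
    and proper: "V \<notin> P"
    and nonempty: "V \<noteq> {}"
    and rb: "r \<noteq> b"
    and cross: "X \<in> P \<Longrightarrow> Y \<in> P \<Longrightarrow> X \<noteq> Y \<Longrightarrow> x \<in> X \<Longrightarrow> y \<in> Y \<Longrightarrow> c x y = r \<or> c x y = b"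
    and hom: "X \<in> P \<Longrightarrow> Y \<in> P \<Longrightarrow> X \<noteq> Y \<Longrightarrow> x \<in> X \<Longrightarrow> x' \<in> X \<Longrightarrow> y \<in> Y \<Longrightarrow> c x y = c x' y"
    and nosplit: "\<not> splittable c V"

text \<open>The partition is a homogeneous one with the fewest parts. Its minimality makes every
  colour between two parts connected on the quotient, so \<open>not_three_spanning\<close> leaves at
  most two colours; a single one would let a part split off.\<close>

theorem gallai_partition:
  fixes c :: "'a \<Rightarrow> 'a \<Rightarrow> 'b"
  assumes sym: "\<And>x y. c x y = c y x"
    and fin: "finite V" and "2 \<le> card V" and rf: "rainbow_free c V" and ns: "\<not> splittable c V"
  obtains P r b where "gallai_reduced c V P r b"
proof -
  define H where "H P \<longleftrightarrow> partition_on V P \<and> V \<notin> P \<and>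
    (\<forall>X\<in>P. \<forall>Y\<in>P. X \<noteq> Y \<longrightarrow> (\<forall>x\<in>X. \<forall>x'\<in>X. \<forall>y\<in>Y. c x y = c x' y))" for P
  have "H ((\<lambda>x. {x}) ` V)"
    using assms(3) unfolding H_def partition_on_def disjoint_def by auto
  then obtain P where HP: "H P" and min: "\<And>Q. H Q \<Longrightarrow> card P \<le> card Q"
    using ex_has_least_nat[of H _ card] by blast
  have part: "partition_on V P" and VP: "V \<notin> P" using HP H_def by auto
  have hom: "c x y = c x' y" if "X \<in> P" "Y \<in> P" "X \<noteq> Y" "x \<in> X" "x' \<in> X" "y \<in> Y" for X Y x x' y
    using HP that unfolding H_def by blast
  have dj: "A \<inter> B = {}" if "A \<in> P" "B \<in> P" "A \<noteq> B" for A B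
    using part that unfolding partition_on_def disjoint_def by auto
  have finP: "finite P" using finite_elements[OF fin part] .
  have Vne: "V \<noteq> {}" using assms(3) by auto
  have P2: "2 \<le> card P"
  proof (rule ccontr)
    assume "\<not> 2 \<le> card P"
    moreover have "P \<noteq> {}" using part Vne unfolding partition_on_def by auto
    ultimately have "card P = 1" using finP card_0_eq by (metis One_nat_def less_2_cases not_le)
    then obtain X where "P = {X}" by (auto simp: card_Suc_eq)
    then show False using part VP unfolding partition_on_def by auto
  qed
  define rep where "rep X = (SOME x. x \<in> X)" for X :: "'a set"
  have rep: "rep X \<in> X" if "X \<in> P" for X
    using that part unfolding rep_def partition_on_def by (metis some_in_eq)
  have repV: "rep X \<in> V" if "X \<in> P" for X
    using rep[OF that] that part unfolding partition_on_def by auto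
  have rep_inj: "rep X \<noteq> rep Y" if "X \<in> P" "Y \<in> P" "X \<noteq> Y" for X Y
    using rep[OF that(1)] rep[OF that(2)] dj[OF that] by auto
  define d where "d X Y = c (rep X) (rep Y)" for X Y
  have d_sym: "d X Y = d Y X" for X Y unfolding d_def by (rule sym)
  have d: "c x y = d X Y" if "X \<in> P" "Y \<in> P" "X \<noteq> Y" "x \<in> X" "y \<in> Y" for X Y x y
    using hom[of X Y x "rep X" y] hom[of Y X y "rep Y" "rep X"] that rep sym unfolding d_def by auto
  have rfd: "rainbow_free d P"
    unfolding rainbow_free_def d_def
  proof (intro ballI impI)
    fix X Y Z assume "X \<in> P" "Y \<in> P" "Z \<in> P" "distinct [X, Y, Z]"
    then show "c (rep X) (rep Y) = c (rep Y) (rep Z) \<or> c (rep Y) (rep Z) = c (rep X) (rep Z) \<or>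
        c (rep X) (rep Y) = c (rep X) (rep Z)"
      using rainbow_freeD[OF rf, of "rep X" "rep Y" "rep Z"] repV rep_inj by auto
  qed
  text \<open>Contracting a component of a colour class of the reduced colouring again gives a
    homogeneous partition.\<close>
  have span: "spanning d P (d X Y)" if XY: "X \<in> P" "Y \<in> P" "X \<noteq> Y" for X Y
  proof (rule ccontr)
    assume ns: "\<not> spanning d P (d X Y)"
    define C where "C = {Z \<in> P. reach d P (d X Y) X Z}"
    have XC: "X \<in> C" "Y \<in> C" "C \<subseteq> P" using XY reach_edge[of X P Y d] C_def by auto
    have "C \<noteq> P"
    proof
      assume "C = P"
      then have "reach d P (d X Y) X Z" if "Z \<in> P" for Z using that C_def by auto
      then have "spanning d P (d X Y)"
        unfolding spanning_def using reach_sym[of d] reach_trans d_sym by metis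
      with ns show False ..
    qed
    then obtain Z where Z: "Z \<in> P" "Z \<notin> C" using XC by auto
    have homC: "d Z' X' = d Z' Y'" if "Z' \<in> P - C" "X' \<in> C" "Y' \<in> C" for X' Y' Z'
      using reach_homogeneous[of d P X Z' "d X Y" X', OF d_sym rfd]
        reach_homogeneous[of d P X Z' "d X Y" Y', OF d_sym rfd] that XY unfolding C_def by auto
    define Q where "Q = insert (\<Union>C) (P - C)"
    have "H Q"
      unfolding H_def
    proof (intro conjI ballI impI)
      have "\<Union>C \<noteq> {}" using XC rep XY by auto
      moreover have "A \<inter> \<Union>C = {}" if "A \<in> P - C" for A
        using dj XC that by blast
      moreover have "\<Union>Q = V"
        using XC(3) part unfolding Q_def partition_on_def by auto
      moreover have "{} \<notin> P" using part unfolding partition_on_def by simp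
      moreover have "A \<inter> B = {}" if AB: "A \<in> Q" "B \<in> Q" "A \<noteq> B" for A B
      proof -
        consider "A \<in> P - C" "B \<in> P - C" | "A = \<Union>C" "B \<in> P - C" | "A \<in> P - C" "B = \<Union>C"
          using AB unfolding Q_def by blast
        then show ?thesis
          by cases (use dj[of A B] AB(3) \<open>\<And>A. A \<in> P - C \<Longrightarrow> A \<inter> \<Union>C = {}\<close> in auto)
      qed
      ultimately show "partition_on V Q"
        unfolding partition_on_def disjoint_def Q_def by auto
      have "rep Z \<notin> \<Union>C" using dj Z XC rep by blast
      then show "V \<notin> Q" using VP repV Z unfolding Q_def by auto
      fix A B x x' y assume A: "A \<in> Q" "B \<in> Q" "A \<noteq> B" "x \<in> A" "x' \<in> A" "y \<in> B"
      then consider "A \<in> P - C" "B \<in> P - C" | "A = \<Union>C" "B \<in> P - C" | "A \<in> P - C" "B = \<Union>C"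
        unfolding Q_def by blast
      then show "c x y = c x' y"
      proof cases
        case 1
        then show ?thesis using hom[of A B x x' y] A by auto
      next
        case 2
        then obtain X1 X2 where X12: "X1 \<in> C" "x \<in> X1" "X2 \<in> C" "x' \<in> X2" using A by blast
        then have "B \<noteq> X1" "B \<noteq> X2" "X1 \<in> P" "X2 \<in> P" using 2 XC by auto
        then have "c y x = d B X1" "c y x' = d B X2" using d X12 2 A by auto
        then show ?thesis using homC[of B X1 X2] 2 X12 sym by simp
      next
        case 3
        then obtain Y' where Y': "Y' \<in> C" "y \<in> Y'" using A by blast
        then have "A \<noteq> Y'" "Y' \<in> P" "A \<in> P" using 3 XC by auto
        then show ?thesis using hom[of A Y' x x' y] Y' A by simp
      qed
    qed
    moreover have "card Q < card P"
    proof -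
      have finC: "finite C" using XC finP finite_subset by blast
      have "card Q \<le> Suc (card (P - C))" unfolding Q_def by (rule card_insert_le_m1) simp_all
      also have "card (P - C) = card P - card C" using finC XC card_Diff_subset by blast
      finally have "card Q \<le> Suc (card P - card C)" .
      moreover have "card {X, Y} \<le> card C" using finC XC by (intro card_mono) auto
      ultimately show ?thesis using XY card_mono[OF finP XC(3)] by simp
    qed
    ultimately show False using min by fastforce
  qed
  obtain X0 Y0 where X0: "X0 \<in> P" "Y0 \<in> P" "X0 \<noteq> Y0" using obtain2[OF P2] .
  define r where "r = d X0 Y0"
  have X0V: "X0 \<subseteq> V" "X0 \<noteq> {}" using X0 part unfolding partition_on_def by auto
  have "\<exists>Y\<in>P. Y \<noteq> X0 \<and> d X0 Y \<noteq> r"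
  proof (rule ccontr)
    assume A: "\<not> ?thesis"
    have "splittable c V"
    proof (rule splittableI[of X0])
      show "X0 \<noteq> V" using X0 VP by auto
      fix x y assume x: "x \<in> X0" "y \<in> V - X0"
      then obtain Y where "Y \<in> P" "y \<in> Y" using part unfolding partition_on_def by auto
      then show "c x y = r" using d[of X0 Y x y] A x X0 by auto
    qed (use X0V in auto)
    then show False using ns by simp
  qed
  then obtain Y1 where Y1: "Y1 \<in> P" "Y1 \<noteq> X0" "d X0 Y1 \<noteq> r" by blast
  define b where "b = d X0 Y1"
  have two: "d X Y = r \<or> d X Y = b" if "X \<in> P" "Y \<in> P" "X \<noteq> Y" for X Y
    using not_three_spanning[of d P r b "d X Y", OF d_sym finP P2 rfd] span[OF that]
      span[OF X0] span[of X0 Y1] Y1 X0 unfolding r_def b_def by auto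
  have "gallai_reduced c V P r b"
    using sym fin part VP Vne Y1 ns hom d two by unfold_locales (auto simp: b_def; metis)+
  then show ?thesis by (rule that)
qed

section \<open>Paths on 4 vertices in the two colours of a Gallai partition\<close>

context gallai_reduced
begin

lemma swap: "gallai_reduced c V P b r"
proof unfold_locales
  show "c x y = b \<or> c x y = r" if "X \<in> P" "Y \<in> P" "X \<noteq> Y" "x \<in> X" "y \<in> Y" for X Y x y
    using cross[OF that] by blast
  show "c x y = c x' y" if "X \<in> P" "Y \<in> P" "X \<noteq> Y" "x \<in> X" "x' \<in> X" "y \<in> Y" for X Y x x' y
    by (rule hom[OF that])
qed (rule sym finite partition proper nonempty rb[symmetric] nosplit)+

definition part :: "'a \<Rightarrow> 'a set" where
  "part x = (THE X. X \<in> P \<and> x \<in> X)"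

lemma disjoint_parts: "X \<in> P \<Longrightarrow> Y \<in> P \<Longrightarrow> X \<noteq> Y \<Longrightarrow> X \<inter> Y = {}"
  using partition unfolding partition_on_def disjoint_def by simp

lemma part_eq: "X \<in> P \<Longrightarrow> x \<in> X \<Longrightarrow> part x = X"
  unfolding part_def using disjoint_parts by (intro the_equality) auto

lemma part:
  assumes "x \<in> V"
  shows "part x \<in> P" "x \<in> part x"
proof -
  obtain X where "X \<in> P" "x \<in> X" using partition assms unfolding partition_on_def by auto
  then show "part x \<in> P" "x \<in> part x" using part_eq by auto
qed

lemma part_sub: "X \<in> P \<Longrightarrow> X \<subseteq> V"
  using partition unfolding partition_on_def by auto

text \<open>Only red edges between different parts are considered. A vertex with two such neighbours
  is alone in its part, and together with them it forms a star that has no red edge to the outside,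
  so the set splits. Otherwise these edges form a matching; no vertex is missed by it, as its part
  would split off, and then the two ends of an edge split off.\<close>

lemma not_P4_free: "\<not> P4_free c V r"
proof
  assume P4: "P4_free c V r"
  define N where "N x = {y \<in> V. part y \<noteq> part x \<and> c x y = r}" for x
  have cross': "c x y = b" if "x \<in> V" "y \<in> V" "part y \<noteq> part x" "y \<notin> N x" for x y
    using that cross[of "part x" "part y" x y] part N_def by auto
  have two_nbrs: False if z: "z \<in> V" "y1 \<in> N z" "y2 \<in> N z" "y1 \<noteq> y2" for z y1 y2
  proof -
    have single: "w = z" if w: "w \<in> V" "part w = part z" for w
    proof (rule ccontr)
      assume "w \<noteq> z"
      have "c w y1 = r"
        using hom[of "part z" "part y1" w z y1] z w part[of w] part[of z] part[of y1]
        unfolding N_def by auto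
      moreover have "y1 \<noteq> w" "y2 \<noteq> w" "z \<noteq> y1" "z \<noteq> y2" using z w N_def by auto
      ultimately show False
        using P4_freeD[OF P4, of w y1 z y2] z w \<open>w \<noteq> z\<close> sym[of z] unfolding N_def by auto
    qed
    let ?S = "insert z (N z)"
    have out: "c y w = b" if "y \<in> ?S" "w \<in> V - ?S" for y w
    proof (cases "y = z")
      case True
      then show ?thesis using cross'[of z w] single[of w] z that by auto
    next
      case False
      then have y: "y \<in> N z" "y \<in> V" using that N_def by auto
      have "part w \<noteq> part y"
      proof
        assume eq: "part w = part y"
        then have "c z w = c z y"
          using hom[of "part y" "part z" w y z] part[of y] part[of w] part[of z] y z that N_def sym by auto
        then show False using y eq that unfolding N_def by auto
      qed
      moreover have "c y w \<noteq> r"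
      proof
        assume "c y w = r"
        moreover obtain y' where "y' \<in> N z" "y' \<noteq> y" using z by metis
        moreover have "z \<noteq> y" "z \<noteq> y'" using y \<open>y' \<in> N z\<close> N_def by auto
        ultimately show False
          using P4_freeD[OF P4, of w y z y'] y z that sym[of z y] sym[of y w] unfolding N_def by auto
      qed
      ultimately show ?thesis
        using cross[of "part y" "part w" y w] part[of y] part[of w] y that by auto
    qed
    have "splittable c V"
    proof (cases "?S = V")
      case True
      show ?thesis
      proof (rule splittableI[of "{z}" V c r])
        show "c x y = r" if "x \<in> {z}" "y \<in> V - {z}" for x y
          using that True N_def by auto
        show "{z} \<noteq> V" using z N_def by auto
      qed (use z in auto)
    next
      case False
      show ?thesis
      proof (rule splittableI[of ?S V c b])
        show "c y w = b" if "y \<in> ?S" "w \<in> V - ?S" for y w using that by (rule out)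
        show "?S \<subseteq> V" using z(1) N_def by auto
      qed (use False in auto)
    qed
    then show False using nosplit by simp
  qed
  obtain x where x: "x \<in> V" using nonempty by auto
  have nbr: "N x \<noteq> {}" if x: "x \<in> V" for x
  proof
    assume N: "N x = {}"
    have "splittable c V"
    proof (rule splittableI[of "part x"])
      show "part x \<subseteq> V" "part x \<noteq> {}" "part x \<noteq> V"
        using part[OF x] part_sub proper by auto
      fix u w assume u: "u \<in> part x" "w \<in> V - part x"
      then have "part w \<noteq> part x" using part[of w] by auto
      then show "c u w = b"
        using hom[of "part x" "part w" u x w] cross'[of x w] part[OF x] part[of w] u N x by auto
    qed
    then show False using nosplit by simp
  qed
  then obtain y where y: "y \<in> N x" using x by auto
  then have yV: "y \<in> V" and xy: "x \<in> N y" "x \<noteq> y" using x sym N_def by auto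
  have Nx: "N x = {y}" and Ny: "N y = {x}"
    using two_nbrs[OF x _ y] two_nbrs[OF yV _ xy(1)] y xy by auto
  have px: "w = u" if "N u = {u'}" "N u' = {u}" "w \<in> V" "part w = part u" "u \<in> V" "u' \<in> V" for w u u'
  proof -
    have "u' \<in> N u" using that by auto
    then have "c u u' = r" "part u' \<noteq> part u" unfolding N_def by auto
    then have "w \<in> N u'"
      using hom[of "part u" "part u'" w u u'] part[of w] part[of u] part[of u'] that(3-6) sym[of u' w]
      unfolding N_def by auto
    then show ?thesis using that by auto
  qed
  have out: "c u w = b" if "u \<in> {x, y}" "w \<in> V - {x, y}" for u w
    using cross'[of u w] px[OF Nx Ny, of w] px[OF Ny Nx, of w] x yV Nx Ny that by auto
  have "splittable c V"
  proof (cases "V = {x, y}")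
    case True
    then show ?thesis
      using xy y N_def by (intro splittableI[of "{x}" V c r]) auto
  next
    case False
    then show ?thesis
    proof (intro splittableI[of "{x, y}" V c b])
      show "c u w = b" if "u \<in> {x, y}" "w \<in> V - {x, y}" for u w using that by (rule out)
    qed (use x yV in auto)
  qed
  then show False using nosplit by simp
qed

end

subsection \<open>The upper bound\<close>

fun gam :: "nat \<Rightarrow> nat" where
  "gam 0 = 1"
| "gam (Suc 0) = 2"
| "gam (Suc (Suc n)) = 5 * gam n"

lemma gam_pos: "1 \<le> gam n"
  by (induction n rule: gam.induct) auto

text \<open>A join in one kipas colour uses up that colour and at most doubles the number of
  vertices. Equality holds for even \<open>n\<close>; for odd \<open>n\<close> the ratio is
  5/2.\<close>

lemma gam_double: "2 * gam n \<le> gam (Suc n)"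
  by (induction n rule: gam.induct) auto

lemma gam_even: "gam (2 * n) = 5 ^ n"
  by (induction n) auto

lemma gam_odd: "gam (Suc (2 * n)) = 2 * 5 ^ n"
  by (induction n) auto

text \<open>The colours in \<open>Q\<close> only occur inside the upper bound induction: a set joined in a kipas colour
  to a single vertex contains no path on 4 vertices in that colour, and a set joined to two
  vertices not even a path on 3 vertices.\<close>

definition admissible :: "('a \<Rightarrow> 'a \<Rightarrow> 'b) \<Rightarrow> 'a set \<Rightarrow> 'b set \<Rightarrow> 'b set \<Rightarrow> 'b set \<Rightarrow> bool" where
  "admissible c V K Q M \<longleftrightarrow> (\<forall>x\<in>V. \<forall>y\<in>V. x \<noteq> y \<longrightarrow> c x y \<in> K \<union> Q \<union> M) \<and>
     (\<forall>i\<in>K. kipas_free c V i) \<and> (\<forall>i\<in>Q. P4_free c V i) \<and> (\<forall>i\<in>M. P3_free c V i) \<and> rainbow_free c V"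

lemma kipas_free_mono:
  assumes "kipas_free c V i" "U \<subseteq> V"
  shows "kipas_free c U i"
  unfolding kipas_free_def
proof (rule notI, elim exE conjE)
  fix v x y z w assume "{v, x, y, z, w} \<subseteq> U" "distinct [v, x, y, z, w]" "c v x = i" "c v y = i" "c v z = i"
    "c v w = i" "c x y = i" "c y z = i" "c z w = i"
  then show False using kipas_freeD[OF assms(1), of v x y z w] assms(2) by auto
qed

lemma P4_free_mono:
  assumes "P4_free c V i" "U \<subseteq> V"
  shows "P4_free c U i"
  unfolding P4_free_def
proof (rule notI, elim exE conjE)
  fix x y z w assume "{x, y, z, w} \<subseteq> U" "distinct [x, y, z, w]" "c x y = i" "c y z = i" "c z w = i"
  then show False using P4_freeD[OF assms(1), of x y z w] assms(2) by auto
qed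

lemma P3_free_mono:
  assumes "P3_free c V i" "U \<subseteq> V"
  shows "P3_free c U i"
  unfolding P3_free_def
proof (rule notI, elim exE conjE)
  fix x y z assume "{x, y, z} \<subseteq> U" "distinct [x, y, z]" "c x y = i" "c y z = i"
  then show False using P3_freeD[OF assms(1), of x y z] assms(2) by auto
qed

lemma rainbow_free_mono: "rainbow_free c V \<Longrightarrow> U \<subseteq> V \<Longrightarrow> rainbow_free c U"
  unfolding rainbow_free_def by blast

lemma P3_free_imp_P4_free:
  assumes "P3_free c V i"
  shows "P4_free c V i"
  unfolding P4_free_def
proof (rule notI, elim exE conjE)
  fix x y z w assume "{x, y, z, w} \<subseteq> V" "distinct [x, y, z, w]" "c x y = i" "c y z = i" "c z w = i"
  then show False using P3_freeD[OF assms, of x y z] by auto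
qed

lemma admissible_color:
  assumes "admissible c V K Q M" "x \<in> V" "y \<in> V" "x \<noteq> y"
  shows "c x y \<in> K \<union> Q \<union> M"
  using assms unfolding admissible_def by blast

lemma admissible_subset:
  assumes "admissible c V K Q M" "U \<subseteq> V"
  shows "admissible c U K Q M"
  using assms unfolding admissible_def
  by (meson kipas_free_mono P4_free_mono P3_free_mono rainbow_free_mono subsetD)

lemma admissible_P3:
  assumes "admissible c V K Q M" "P3_free c V i"
  shows "admissible c V (K - {i}) Q (insert i M)"
  using assms unfolding admissible_def by auto

lemma admissible_P4:
  assumes "admissible c V K Q M" "P4_free c V i"
  shows "admissible c V (K - {i}) (insert i Q) M"
  using assms unfolding admissible_def by auto

lemma admissible_unused:
  assumes "admissible c V K Q M" "\<And>x y. x \<in> V \<Longrightarrow> y \<in> V \<Longrightarrow> x \<noteq> y \<Longrightarrow> c x y \<noteq> i"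
  shows "admissible c V (K - {i}) (Q - {i}) (M - {i})"
  using assms unfolding admissible_def by auto

text \<open>A path \<open>x\<close>, \<open>y\<close>, \<open>z\<close> in \<open>B\<close> and two
  vertices of \<open>A\<close> give the kipas with centre \<open>y\<close> and path
  \<open>x\<close>, \<open>a\<close>, \<open>z\<close>, \<open>a'\<close>.\<close>

lemma kipas_free_join_P3:
  assumes sym: "\<And>x y. c x y = c y x"
    and "kipas_free c V i" "A \<subseteq> V" "B \<subseteq> V" "A \<inter> B = {}" "2 \<le> card A" "\<And>x y. x \<in> A \<Longrightarrow> y \<in> B \<Longrightarrow> c x y = i"
  shows "P3_free c B i"
  unfolding P3_free_def
proof (rule notI, elim exE conjE)
  fix x y z assume xyz: "{x, y, z} \<subseteq> B" "distinct [x, y, z]" "c x y = i" "c y z = i"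
  obtain a a' where a: "a \<in> A" "a' \<in> A" "a \<noteq> a'" using obtain2[OF assms(6)] .
  have j: "c a u = i" "c u a = i" "c a' u = i" "c u a' = i" if "u \<in> B" for u
    using assms(7) a that sym[of u] by simp_all
  have "x \<in> B" "y \<in> B" "z \<in> B" using xyz(1) by auto
  moreover have "a \<notin> B" "a' \<notin> B" using a assms(5) by auto
  moreover have "a \<in> V" "a' \<in> V" "x \<in> V" "y \<in> V" "z \<in> V" using a xyz(1) assms(3,4) by auto
  moreover have "c y x = i" using xyz sym by simp
  ultimately show False
    using kipas_freeD[OF assms(2), of y x a z a'] xyz(2-4) a(3) j by auto
qed

lemma kipas_free_join_P4:
  assumes sym: "\<And>x y. c x y = c y x"
    and "kipas_free c V i" "A \<subseteq> V" "B \<subseteq> V" "A \<inter> B = {}" "A \<noteq> {}" "\<And>x y. x \<in> A \<Longrightarrow> y \<in> B \<Longrightarrow> c x y = i"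
  shows "P4_free c B i"
  unfolding P4_free_def
proof (rule notI, elim exE conjE)
  fix x y z w assume xyz: "{x, y, z, w} \<subseteq> B" "distinct [x, y, z, w]" "c x y = i" "c y z = i" "c z w = i"
  obtain a where a: "a \<in> A" using assms(6) by auto
  have "a \<notin> B" using a assms(5) by auto
  moreover have "x \<in> B" "y \<in> B" "z \<in> B" "w \<in> B" using xyz(1) by auto
  moreover have "a \<in> V" "x \<in> V" "y \<in> V" "z \<in> V" "w \<in> V" using a xyz(1) assms(3,4) by auto
  ultimately show False
    using kipas_freeD[OF assms(2), of a x y z w] xyz(2-5) assms(7)[OF a] by auto
qed

section \<open>Neighbourhoods of a part in the two colours of the partition\<close>

locale prime_coloring = gallai_reduced +
  assumes kr: "kipas_free c V r" and kb: "kipas_free c V b"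
begin

lemma swap': "prime_coloring c V P b r"
  using swap kr kb by (simp add: prime_coloring_def prime_coloring_axioms_def)

definition nb :: "'b \<Rightarrow> 'a set \<Rightarrow> 'a set" where
  "nb i X = {y \<in> V - X. \<forall>x\<in>X. c x y = i}"

lemma nb_decomposition:
  assumes "X \<in> P"
  shows "V = X \<union> nb r X \<union> nb b X" "X \<noteq> {}" "X \<inter> nb i X = {}" "nb r X \<inter> nb b X = {}"
proof -
  show ne: "X \<noteq> {}" using partition assms unfolding partition_on_def by auto
  then obtain x where x: "x \<in> X" by auto
  have XV: "X \<subseteq> V" using part_sub[OF assms] .
  have "y \<in> nb r X \<union> nb b X" if y: "y \<in> V - X" for y
  proof -
    have "part y \<in> P" "y \<in> part y" "part y \<noteq> X" using y part[of y] by auto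
    then have "c u y = c x y" if "u \<in> X" for u
      using hom[of X "part y" u x y] assms x that by simp
    moreover have "c x y = r \<or> c x y = b"
      using cross[of X "part y" x y] assms x \<open>part y \<in> P\<close> \<open>y \<in> part y\<close> \<open>part y \<noteq> X\<close> by simp
    ultimately show ?thesis using y unfolding nb_def by auto
  qed
  then show "V = X \<union> nb r X \<union> nb b X" using XV unfolding nb_def by auto
  show "X \<inter> nb i X = {}" "nb r X \<inter> nb b X = {}" using x rb unfolding nb_def by auto
qed

lemma nb_ne:
  assumes "X \<in> P"
  shows "nb r X \<noteq> {}"
proof
  assume E: "nb r X = {}"
  have "splittable c V"
  proof (rule splittableI[of X V c b])
    show "X \<subseteq> V" "X \<noteq> {}" "X \<noteq> V" using assms nb_decomposition(2) part_sub proper by auto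
    show "c x y = b" if "x \<in> X" "y \<in> V - X" for x y
      using that nb_decomposition(1)[OF assms] E unfolding nb_def by blast
  qed
  then show False using nosplit by simp
qed

lemma part_in_nb:
  assumes "X \<in> P" "y \<in> nb i X"
  shows "part y \<subseteq> nb i X"
proof
  fix w assume w: "w \<in> part y"
  have y: "y \<in> V" "part y \<in> P" "y \<in> part y" "part y \<noteq> X"
    using assms part[of y] unfolding nb_def by auto
  then have "w \<in> V - X" using w disjoint_parts[of "part y" X] part_sub assms by auto
  moreover have "c x w = i" if "x \<in> X" for x
    using hom[of "part y" X w y x] y assms that w sym unfolding nb_def by auto
  ultimately show "w \<in> nb i X" unfolding nb_def by auto
qed

text \<open>Since \<open>X\<close> has two vertices, red is a matching on its red neighbourhood, so
  a part of size at least 2 is joined in blue to everything else there. To avoid a blue kipas, two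
  such parts admit no further vertex, one admits at most two, and without any there are at most four
  vertices.\<close>

lemma nb_structure:
  assumes X: "X \<in> P" "2 \<le> card X" and m: "\<And>Y. Y \<in> P \<Longrightarrow> card Y \<le> m" "2 \<le> m"
  obtains (two) Y Z where "Y \<in> P" "Z \<in> P" "Y \<noteq> Z" "nb r X = Y \<union> Z" "\<And>y z. y \<in> Y \<Longrightarrow> z \<in> Z \<Longrightarrow> c y z = b"
  | (small) "card (nb r X) \<le> m + 2"
proof -
  let ?W = "nb r X"
  have WV: "?W \<subseteq> V" and finW: "finite ?W" using finite unfolding nb_def by auto
  have P3: "P3_free c ?W r"
    by (rule kipas_free_join_P3[OF sym kr part_sub[OF X(1)] WV nb_decomposition(3)[OF X(1)] X(2)]) (auto simp: nb_def)
  have pW: "part y \<in> P" "y \<in> part y" "part y \<subseteq> ?W" if "y \<in> ?W" for y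
    using part[of y] WV that part_in_nb[OF X(1) that] by auto
  have blue: "c w y = b" if w: "w \<in> ?W" and y: "y \<in> ?W" "2 \<le> card (part y)" "part w \<noteq> part y" for w y
  proof (rule ccontr)
    assume "c w y \<noteq> b"
    then have wy: "c w y = r" using cross[of "part w" "part y" w y] w y pW by auto
    obtain u u' where u: "u \<in> part y" "u' \<in> part y" "u \<noteq> u'" using obtain2[OF y(2)] .
    have "c w u = r" "c w u' = r"
      using hom[of "part y" "part w" y u w] hom[of "part y" "part w" y u' w] pW[OF w] pW[OF y(1)] u y wy sym
      by auto
    moreover have "w \<notin> part y" using w y pW part_eq by metis
    ultimately show False
      using P3_freeD[OF P3, of u w u'] u w pW[OF y(1)] sym[of u w] by auto
  qed
  show thesis
  proof (cases "\<exists>y\<in>?W. 2 \<le> card (part y)")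
    case False
    have single: "x = y" if "x \<in> ?W" "y \<in> ?W" "part x = part y" for x y
    proof (rule ccontr)
      assume "x \<noteq> y"
      moreover have "{x, y} \<subseteq> part x" using pW[OF that(1)] pW[OF that(2)] that(3) by simp
      moreover have "finite (part x)" using pW(3)[OF that(1)] finW finite_subset by blast
      ultimately have "2 \<le> card (part x)" using card_mono[of "part x" "{x, y}"] by auto
      then show False using False that by auto
    qed
    have two: "c x y = b \<or> c x y = r" if "x \<in> ?W" "y \<in> ?W" "x \<noteq> y" for x y
      using cross[of "part x" "part y" x y] pW[OF that(1)] pW[OF that(2)] that single[of x y] by auto
    have "card ?W \<le> 4"
    proof (rule ccontr)
      assume "\<not> card ?W \<le> 4"
      then show False
        using kipas_in_matching_complement[OF sym two _ kipas_free_mono[OF kb WV] P3] by auto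
    qed
    then show thesis using small m(2) by auto
  next
    case True
    then obtain y where y: "y \<in> ?W" "2 \<le> card (part y)" by auto
    show thesis
    proof (cases "\<exists>z\<in>?W. part z \<noteq> part y \<and> 2 \<le> card (part z)")
      case True
      then obtain z where z: "z \<in> ?W" "part z \<noteq> part y" "2 \<le> card (part z)" by auto
      have yz: "c u v = b" if "u \<in> part y" "v \<in> part z" for u v
        using blue[of u v] that pW(3)[OF y(1)] pW(3)[OF z(1)] z part_eq[OF pW(1)[OF y(1)], of u]
          part_eq[OF pW(1)[OF z(1)], of v] by auto
      have "?W \<subseteq> part y \<union> part z"
      proof (rule subsetI, rule ccontr)
        fix w assume w: "w \<in> ?W" "w \<notin> part y \<union> part z"
        have b: "c w u = b" if "u \<in> part y \<union> part z" for u
        proof -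
          have "u \<in> ?W" using that pW(3)[OF y(1)] pW(3)[OF z(1)] by auto
          have pu: "part u = part y \<or> part u = part z"
            using that part_eq[OF pW(1)[OF y(1)], of u] part_eq[OF pW(1)[OF z(1)], of u] by auto
          have "part w \<noteq> part y" "part w \<noteq> part z" using w(2) pW(2)[OF w(1)] by auto
          then have "part w \<noteq> part u" "2 \<le> card (part u)" using pu y(2) z(3) by metis+
          then show ?thesis using blue[OF w(1)] \<open>u \<in> ?W\<close> by simp
        qed
        obtain u u' where u: "u \<in> part y" "u' \<in> part y" "u \<noteq> u'" using obtain2[OF y(2)] .
        obtain v v' where v: "v \<in> part z" "v' \<in> part z" "v \<noteq> v'" using obtain2[OF z(3)] .
        have "part y \<inter> part z = {}"
          using disjoint_parts[OF pW(1)[OF y(1)] pW(1)[OF z(1)]] z(2) by auto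
        then have "distinct [w, u, v, u', v']" using u v w by auto
        moreover have "w \<in> V" "u \<in> V" "u' \<in> V" "v \<in> V" "v' \<in> V"
          using u v w pW(3)[OF y(1)] pW(3)[OF z(1)] WV by auto
        \<comment> \<open>The blue kipas has centre \<open>w\<close> and path \<open>u\<close>,
          \<open>v\<close>, \<open>u'\<close>, \<open>v'\<close>.\<close>
        ultimately show False
          using kipas_freeD[OF kb, of w u v u' v'] b[of u] b[of v] b[of u'] b[of v'] yz[OF u(1) v(1)]
            yz[OF u(2) v(1)] yz[OF u(2) v(2)] u v sym[of v u'] by auto
      qed
      then have "?W = part y \<union> part z" using pW(3)[OF y(1)] pW(3)[OF z(1)] by auto
      then show thesis
        using two[OF pW(1)[OF y(1)] pW(1)[OF z(1)] z(2)[symmetric] _ yz] by blast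
    next
      case False
      have pne: "part w \<noteq> part y" if "w \<in> ?W - part y" for w
        using that pW(2)[of w] by auto
      have wy: "c w u = b" if "w \<in> ?W - part y" "u \<in> part y" for w u
        using blue[of w u] that pne[of w] y pW(3)[OF y(1)] part_eq[OF pW(1)[OF y(1)], of u] by auto
      have "card (?W - part y) \<le> 2"
      proof (rule ccontr)
        assume "\<not> card (?W - part y) \<le> 2"
        then have "3 \<le> card (?W - part y)" by simp
        then obtain w1 w2 w3 where w: "w1 \<in> ?W - part y" "w2 \<in> ?W - part y" "w3 \<in> ?W - part y" "distinct [w1, w2, w3]"
          by (rule obtain3)
        have ww: "c u v = r \<or> c u v = b" if uv: "u \<in> ?W - part y" "v \<in> ?W - part y" "u \<noteq> v" for u v
        proof -
          have "part u \<noteq> part v"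
          proof
            assume "part u = part v"
            then have "{u, v} \<subseteq> part u" using pW[of u] pW[of v] uv by auto
            moreover have "finite (part u)" using pW(3)[of u] uv finW finite_subset by auto
            ultimately have "2 \<le> card (part u)" using card_mono[of "part u" "{u, v}"] uv by auto
            then show False using False uv pne by auto
          qed
          then show ?thesis using cross[of "part u" "part v" u v] pW[of u] pW[of v] uv by auto
        qed
        obtain u u' where u: "u \<in> part y" "u' \<in> part y" "u \<noteq> u'" using obtain2[OF y(2)] .
        \<comment> \<open>The blue kipas has centre \<open>p\<close> and path \<open>q\<close>,
          \<open>u\<close>, \<open>s\<close>, \<open>u'\<close>. As red is a matching, among three
          vertices one is blue to both others.\<close>
        have no: False if "c p q = b" "c p s = b" "p \<in> ?W - part y" "q \<in> ?W - part y" "s \<in> ?W - part y" "distinct [p, q, s]" for p q s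
          using kipas_freeD[OF kb, of p q u s u'] that u wy[of p u] wy[of p u'] wy[of q u] wy[of s u] wy[of s u']
            sym[of u s] WV pW(3)[OF y(1)] by auto
        have not2: "c p q = b \<or> c p s = b" if "p \<in> ?W - part y" "q \<in> ?W - part y" "s \<in> ?W - part y" "distinct [p, q, s]" for p q s
          using P3_freeD[OF P3, of q p s] ww[of p q] ww[of p s] that sym[of q p] by auto
        show False
          using no[of w1 w2 w3] no[of w2 w1 w3] no[of w3 w1 w2] not2[of w1 w2 w3] not2[of w2 w1 w3] not2[of w3 w1 w2]
            w sym[of w2 w1] sym[of w3 w1] sym[of w3 w2] by auto
      qed
      moreover have "card ?W \<le> card (part y) + card (?W - part y)"
        using card_Un_le[of "part y" "?W - part y"] pW(3)[OF y(1)] by (simp add: Un_absorb1)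
      moreover have "card (part y) \<le> m" using m(1) pW(1)[OF y(1)] by simp
      ultimately show thesis using small by simp
    qed
  qed
qed

lemma nb_card_le:
  assumes X: "X \<in> P" "2 \<le> card X" and m: "\<And>Y. Y \<in> P \<Longrightarrow> card Y \<le> m" "2 \<le> m"
  shows "card (nb r X) \<le> 2 * m"
proof (rule nb_structure[OF X m])
  fix Y Z assume YZ: "Y \<in> P" "Z \<in> P" "nb r X = Y \<union> Z"
  then have "card (nb r X) \<le> card Y + card Z" using card_Un_le by auto
  then show ?thesis using YZ m(1)[of Y] m(1)[of Z] by simp
qed (use m(2) in auto)

lemma nb_P3_free:
  assumes "X \<in> P" "2 \<le> card (nb r X)"
  shows "P3_free c X r"
  by (rule kipas_free_join_P3[OF sym kr _ part_sub[OF assms(1)] _ assms(2)])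
    (use nb_decomposition(3)[OF assms(1), of r] sym in \<open>auto simp: nb_def\<close>)

lemma nb_P4_free:
  assumes "X \<in> P"
  shows "P4_free c X r"
  by (rule kipas_free_join_P4[OF sym kr _ part_sub[OF assms(1)] _ nb_ne[OF assms]])
    (use nb_decomposition(3)[OF assms(1), of r] sym in \<open>auto simp: nb_def\<close>)

text \<open>If \<open>X\<close> has just one neighbour in each colour, the colour of the edge
  between these two lets one of them split off.\<close>

lemma nb_not_both_single:
  assumes "X \<in> P" "card (nb r X) \<le> 1" "card (nb b X) \<le> 1"
  shows False
proof -
  interpret sw: prime_coloring c V P b r by (rule swap')
  have fin: "finite (nb r X)" "finite (nb b X)" using finite unfolding nb_def by auto
  obtain x where x: "nb r X = {x}"
    using assms(2) nb_ne[OF assms(1)] fin by (metis card_1_singletonE card_0_eq le_neq_implies_less less_one)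
  obtain y where y: "nb b X = {y}"
    using assms(3) sw.nb_ne[OF assms(1)] fin by (metis card_1_singletonE card_0_eq le_neq_implies_less less_one)
  have V: "V = X \<union> {x, y}" "x \<notin> X" "y \<notin> X" "x \<noteq> y" "X \<noteq> {}"
    using nb_decomposition[OF assms(1)] x y nb_decomposition(3)[OF assms(1), of r] nb_decomposition(3)[OF assms(1), of b] by auto
  have "x \<in> nb r X" "y \<in> nb b X" using x y by simp_all
  then have c: "c x u = r" "c y u = b" if "u \<in> X" for u
    using that sym[of x u] sym[of y u] unfolding nb_def by simp_all
  have "part x \<noteq> part y"
  proof
    assume "part x = part y"
    then have "part x \<subseteq> {x}" "y \<in> part x"
      using part_in_nb[OF assms(1), of x r] x part(2)[of y] V by auto
    then show False using V by auto
  qed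
  then have "c x y = r \<or> c x y = b" using cross[of "part x" "part y" x y] part V by auto
  then have "splittable c V"
  proof
    assume "c x y = r"
    then show ?thesis using V c by (intro splittableI[of "{x}" V c r]) auto
  next
    assume "c x y = b"
    then show ?thesis using V c sym[of y x] by (intro splittableI[of "{y}" V c b]) auto
  qed
  then show False using nosplit by simp
qed

lemma card_V:
  assumes "X \<in> P"
  shows "card V = card X + card (nb r X) + card (nb b X)"
proof -
  have fin: "finite X" "finite (nb r X)" "finite (nb b X)"
    using finite part_sub[OF assms] finite_subset unfolding nb_def by auto
  have "card V = card (X \<union> nb r X) + card (nb b X)"
    using nb_decomposition[OF assms] nb_decomposition(3)[OF assms, of b] fin by (metis card_Un_disjoint finite_Un inf_sup_distrib2 sup_bot.right_neutral)
  also have "card (X \<union> nb r X) = card X + card (nb r X)"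
    using nb_decomposition(3)[OF assms, of r] fin by (simp add: card_Un_disjoint)
  finally show ?thesis .
qed

text \<open>For a largest part \<open>X\<close>, a colour with at least two neighbours of
  \<open>X\<close> has no path on 3 vertices inside \<open>X\<close>, and a colour with a single
  neighbour has no path on 4. The sizes are \<open>1 + 2 + 2\<close> times \<open>card X\<close>
  when both colours have two neighbours, and \<open>1 + 2\<close> times \<open>card X\<close> plus
  the single neighbour otherwise.\<close>

lemma size_cases:
  obtains (singletons) "card V \<le> 9"
  | (big) X where "X \<in> P" "2 \<le> card X" "\<And>Y. Y \<in> P \<Longrightarrow> card Y \<le> card X" "card V \<le> 5 * card X"
      "P3_free c X r" "P3_free c X b"
  | (red) X where "X \<in> P" "card V \<le> 3 * card X + 1" "P4_free c X r" "P3_free c X b"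
  | (blue) X where "X \<in> P" "card V \<le> 3 * card X + 1" "P4_free c X b" "P3_free c X r"
proof -
  interpret sw: prime_coloring c V P b r by (rule swap')
  have finP: "finite P" using finite_elements[OF finite partition] .
  have Pne: "P \<noteq> {}" using partition nonempty unfolding partition_on_def by auto
  have "Max (card ` P) \<in> card ` P" using finP Pne by simp
  then obtain X where X: "X \<in> P" and max: "card X = Max (card ` P)" by auto
  have "card Y \<le> card X" if "Y \<in> P" for Y
    using finP that max by simp
  with X have X: "X \<in> P" "\<And>Y. Y \<in> P \<Longrightarrow> card Y \<le> card X" by auto
  show thesis
  proof (cases "2 \<le> card X")
    case False
    have "two_coloring c V r b"
    proof unfold_locales
      fix x y assume xy: "x \<in> V" "y \<in> V" "x \<noteq> y"
      have "part x \<noteq> part y"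
      proof
        assume "part x = part y"
        then have "{x, y} \<subseteq> part x" using part xy by auto
        moreover have "finite (part x)" using part[of x] part_sub[of "part x"] xy finite finite_subset by auto
        ultimately have "2 \<le> card (part x)" using card_mono[of "part x" "{x, y}"] xy by auto
        then show False using False X(2)[of "part x"] part xy by auto
      qed
      then show "c x y = r \<or> c x y = b" using cross[of "part x" "part y" x y] part xy by auto
    qed (rule sym finite rb kr kb)+
    then show thesis by (intro singletons two_coloring.card_le_9)
  next
    case True
    have le: "card (nb r X) \<le> 2 * card X" "card (nb b X) \<le> 2 * card X"
      using nb_card_le[OF X(1) True X(2) True] sw.nb_card_le[OF X(1) True X(2) True] by auto
    note cV = card_V[OF X(1)]
    have ge2: "2 \<le> n \<or> n \<le> 1" for n :: nat by linarith
    consider "2 \<le> card (nb r X)" "2 \<le> card (nb b X)" | "card (nb r X) \<le> 1" "2 \<le> card (nb b X)"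
      | "card (nb b X) \<le> 1" "2 \<le> card (nb r X)"
      using nb_not_both_single[OF X(1)] ge2 by blast
    then show thesis
    proof cases
      case 1
      then show thesis
        using big[OF X(1) True X(2)] le cV nb_P3_free[OF X(1)] sw.nb_P3_free[OF X(1)] by simp
    next
      case 2
      then show thesis
        using red[OF X(1)] le cV nb_P4_free[OF X(1)] sw.nb_P3_free[OF X(1)] by simp
    next
      case 3
      then show thesis
        using blue[OF X(1)] le cV sw.nb_P4_free[OF X(1)] nb_P3_free[OF X(1)] by simp
    qed
  qed
qed

end

lemma (in gallai_reduced) kipas_color:
  assumes "admissible c V K Q M"
  shows "r \<in> K"
proof -
  obtain x y where "x \<in> V" "y \<in> V" "x \<noteq> y" "c x y = r"
    using not_P4_free unfolding P4_free_def by auto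
  then have "r \<in> K \<union> Q \<union> M" using admissible_color[OF assms] by metis
  moreover have "r \<notin> Q" using assms not_P4_free unfolding admissible_def by auto
  moreover have "r \<notin> M"
    using assms not_P4_free P3_free_imp_P4_free[of c V r] unfolding admissible_def by auto
  ultimately show ?thesis by simp
qed

lemma admissible_prime_coloring:
  assumes "gallai_reduced c V P r b" "admissible c V K Q M"
  shows "prime_coloring c V P r b" "r \<in> K" "b \<in> K" "r \<noteq> b"
proof -
  interpret gallai_reduced c V P r b by (rule assms(1))
  interpret sw: gallai_reduced c V P b r by (rule swap)
  show r: "r \<in> K" and b: "b \<in> K" using kipas_color sw.kipas_color assms(2) by auto
  show "prime_coloring c V P r b"
    using assms r b unfolding prime_coloring_def prime_coloring_axioms_def admissible_def by auto
  show "r \<noteq> b" by (rule rb)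
qed

lemma splittable_cases:
  assumes sym: "\<And>x y. c x y = c y x" and "finite V" "splittable c V"
  obtains A B i where "A \<subseteq> V" "B \<subseteq> V" "A \<inter> B = {}" "1 \<le> card A" "card A \<le> card B"
    "card V = card A + card B" "\<forall>x\<in>A. \<forall>y\<in>B. c x y = i \<and> c y x = i"
proof -
  obtain A B i where AB: "A \<noteq> {}" "B \<noteq> {}" "A \<inter> B = {}" "A \<union> B = V" "\<forall>x\<in>A. \<forall>y\<in>B. c x y = i"
    using assms(3) unfolding splittable_def by blast
  have fin: "finite A" "finite B" using AB(4) assms(2) by auto
  then have cV: "card V = card A + card B" using AB card_Un_disjoint by metis
  have ne: "1 \<le> card A" "1 \<le> card B" using AB fin by (simp_all add: Suc_le_eq card_gt_0_iff)
  have c: "c x y = i" "c y x = i" if "x \<in> A" "y \<in> B" for x y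
    using AB(5) that sym[of y x] by auto
  show thesis
  proof (cases "card A \<le> card B")
    case True
    show thesis by (rule that[of A B i]) (use AB(3,4) ne cV True c in auto)
  next
    case False
    show thesis by (rule that[of B A i]) (use AB(3,4) ne cV False c in auto)
  qed
qed

text \<open>Each step passes to a smaller set where some colours have moved from \<open>K\<close> to
  \<open>Q\<close> or \<open>M\<close>, or where one has left \<open>Q\<close>. The inequalities in
  the proof say that the bound pays for every such move.\<close>

theorem card_admissible_le:
  fixes c :: "'a \<Rightarrow> 'a \<Rightarrow> 'b"
  assumes sym: "\<And>x y. c x y = c y x"
    and "finite V" "finite K" "finite Q" "admissible c V K Q M"
  shows "card V \<le> (card Q + 2) * gam (card K)"
  using assms(2-)
proof (induction "card V" arbitrary: V K Q M rule: less_induct)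
  case less
  note fin = less.prems(1-3) and adm = less.prems(4)
  have two: "2 \<le> (card Q + 2) * gam (card K)"
    using mult_le_mono[of 2 "card Q + 2" 1 "gam (card K)"] gam_pos[of "card K"] by simp
  show ?case
  proof (cases "card V \<le> 2")
    case True
    then show ?thesis using two by simp
  next
    case False
    then have V3: "3 \<le> card V" by simp
    show ?thesis
    proof (cases "splittable c V")
      case True
      obtain A B i where AB: "A \<subseteq> V" "B \<subseteq> V" "A \<inter> B = {}" "1 \<le> card A" "card A \<le> card B"
        "card V = card A + card B" "\<forall>x\<in>A. \<forall>y\<in>B. c x y = i \<and> c y x = i"
        by (rule splittable_cases[OF sym fin(1) True])
      have cAB: "c x y = i" if "x \<in> A" "y \<in> B" for x y using AB(7) that by auto
      have cBA: "c x y = i" if "x \<in> B" "y \<in> A" for x y using AB(7) that by auto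
      have finAB: "finite A" "finite B" using AB fin finite_subset by auto
      have ltA: "card A < card V" and ltB: "card B < card V" using AB by auto
      have B2: "2 \<le> card B" using AB V3 by simp
      obtain a where a: "a \<in> A" using AB(4) by fastforce
      obtain b b' where b: "b \<in> B" "b' \<in> B" "b \<noteq> b'" using obtain2[OF B2] .
      have ab: "a \<notin> B" "b \<notin> A" "b' \<notin> A" using a b AB(3) by auto
      have inV: "a \<in> V" "b \<in> V" "b' \<in> V" using a b AB by auto
      have i: "i \<in> K \<union> Q \<union> M" using admissible_color[OF adm, of a b] cAB a b ab inV by metis
      have "i \<notin> M"
      proof
        assume "i \<in> M"
        then have "P3_free c V i" using adm unfolding admissible_def by auto
        then show False
          using P3_freeD[of c V i b a b'] a b ab inV cAB[OF a b(2)] cBA[OF b(1) a] by auto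
      qed
      show ?thesis
      proof (cases "i \<in> K")
        case True
        then have kf: "kipas_free c V i" using adm unfolding admissible_def by auto
        obtain k where k: "card K = Suc k" "card (K - {i}) = k"
          using True fin(2) by (metis card_Suc_Diff1)
        show ?thesis
        proof (cases "2 \<le> card A")
          case True
          have "P3_free c A i" "P3_free c B i"
            using kipas_free_join_P3[OF sym kf AB(2,1) _ B2 cBA] kipas_free_join_P3[OF sym kf AB(1,2,3) True cAB] AB(3)
            by auto
          then have "card A \<le> (card Q + 2) * gam k" "card B \<le> (card Q + 2) * gam k"
            using less.hyps[OF ltA finAB(1) _ fin(3) admissible_P3[OF admissible_subset[OF adm AB(1)]], of i]
              less.hyps[OF ltB finAB(2) _ fin(3) admissible_P3[OF admissible_subset[OF adm AB(2)]], of i] fin k by auto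
          then have "card V \<le> (card Q + 2) * (2 * gam k)" using AB(6) by simp
          also have "\<dots> \<le> (card Q + 2) * gam (card K)"
            unfolding k(1) using gam_double by (rule mult_le_mono2)
          finally show ?thesis .
        next
          case False
          then have A1: "card A = 1" using AB by simp
          have "P4_free c B i"
            using kipas_free_join_P4[OF sym kf AB(1,2,3) _ cAB] a by auto
          then have "card B \<le> (card (insert i Q) + 2) * gam k"
            using less.hyps[OF ltB finAB(2) _ _ admissible_P4[OF admissible_subset[OF adm AB(2)]], of i] fin k by auto
          also have "\<dots> \<le> (card Q + 3) * gam k"
            using fin(3) by (intro mult_le_mono1) (simp add: card_insert_if)
          finally have "card V \<le> 1 + (card Q + 3) * gam k" using A1 AB by simp
          \<comment> \<open>After cancellation this is
            \<open>1 \<le> (card Q + 1) * gam k\<close>.\<close>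
          also have "\<dots> \<le> (card Q + 2) * (2 * gam k)" using gam_pos[of k] by (simp add: algebra_simps)
          also have "\<dots> \<le> (card Q + 2) * gam (card K)"
            unfolding k(1) using gam_double by (rule mult_le_mono2)
          finally show ?thesis .
        qed
      next
        case False
        then have iQ: "i \<in> Q" using i \<open>i \<notin> M\<close> by auto
        then have pf: "P4_free c V i" using adm unfolding admissible_def by auto
        have Q1: "1 \<le> card Q" using iQ fin by (auto simp: Suc_le_eq card_gt_0_iff)
        \<comment> \<open>Two vertices on each side give the path \<open>u\<close>,
          \<open>b\<close>, \<open>u'\<close>, \<open>b'\<close>.\<close>
        have A1: "card A = 1"
        proof (rule ccontr)
          assume "card A \<noteq> 1"
          then have "2 \<le> card A" using AB by simp
          then obtain u u' where u: "u \<in> A" "u' \<in> A" "u \<noteq> u'" by (rule obtain2)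
          then have "u \<notin> B" "u' \<notin> B" "u \<in> V" "u' \<in> V" using AB by auto
          then show False
            using P4_freeD[OF pf, of u b u' b'] u b inV cAB cBA by auto
        qed
        have gam1: "1 \<le> gam (card K)" by (rule gam_pos)
        show ?thesis
        proof (cases "card B = 2")
          case True
          then have "card V = 3 * 1" using A1 AB by simp
          also have "\<dots> \<le> (card Q + 2) * gam (card K)" using Q1 gam1 by (intro mult_le_mono) auto
          finally show ?thesis .
        next
          case False
          then have B3: "3 \<le> card B" using B2 by simp
          \<comment> \<open>With a third vertex \<open>z\<close> of \<open>B\<close> there would be
            the path \<open>z\<close>, \<open>a\<close>, \<open>x\<close>, \<open>y\<close>. For
            \<open>card B = 2\<close> there is no such \<open>z\<close>, and the edge in
            \<open>B\<close> may have colour \<open>i\<close>.\<close>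
          have "c x y \<noteq> i" if xy: "x \<in> B" "y \<in> B" "x \<noteq> y" for x y
          proof
            assume c: "c x y = i"
            have "card (B - {x, y}) \<ge> 1" using B3 xy finAB by (subst card_Diff_subset) auto
            then have "B - {x, y} \<noteq> {}" by (metis card.empty not_one_le_zero)
            then obtain z where z: "z \<in> B" "z \<noteq> x" "z \<noteq> y" by auto
            have "x \<in> V" "y \<in> V" "z \<in> V" using AB xy z by auto
            moreover have "a \<noteq> x" "a \<noteq> y" "a \<noteq> z" using ab xy z by auto
            ultimately show False
              using P4_freeD[OF pf, of z a x y] xy z inV c cAB[OF a xy(1)] cBA[OF z(1) a] by auto
          qed
          then have "admissible c B (K - {i}) (Q - {i}) (M - {i})"
            using admissible_unused[OF admissible_subset[OF adm AB(2)]] by blast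
          then have "card B \<le> (card (Q - {i}) + 2) * gam (card (K - {i}))"
            using less.hyps[OF ltB finAB(2)] fin by simp
          also have "K - {i} = K" using False \<open>i \<notin> K\<close> by simp
          also have "card (Q - {i}) + 2 = card Q + 1" using iQ fin Q1 by simp
          finally have "card V \<le> 1 + (card Q + 1) * gam (card K)" using A1 AB by simp
          also have "\<dots> \<le> (card Q + 2) * gam (card K)" using gam1 by simp
          finally show ?thesis .
        qed
      qed
    next
      case False
      obtain P r b where G: "gallai_reduced c V P r b"
        using gallai_partition[OF sym fin(1) _ _ False] V3 adm unfolding admissible_def by auto
      note pc = admissible_prime_coloring[OF G adm]
      interpret prime_coloring c V P r b by (rule pc(1))
      obtain k where k: "card K = Suc (Suc k)" "card (K - {r} - {b}) = k"
        using pc(2-4) fin(2) by (metis card_Suc_Diff1 finite_Diff insertE insert_Diff)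
      have kk: "card (K - {b} - {r}) = k" using k(2) by (metis Diff_insert insert_commute)
      have part_lt: "card X < card V" if "X \<in> P" for X
        using that part_sub proper fin(1) by (metis psubsetI psubset_card_mono)
      have finX: "finite X" if "X \<in> P" for X using that part_sub fin(1) finite_subset by metis
      have one: ?thesis if X: "X \<in> P" "card V \<le> 3 * card X + 1" "P4_free c X i" "P3_free c X j"
        and ij: "card (K - {j} - {i}) = k" for X i j
      proof -
        have "admissible c X (K - {j} - {i}) (insert i Q) (insert j M)"
          using admissible_P4[OF admissible_P3[OF admissible_subset[OF adm part_sub[OF X(1)]] X(4)] X(3)] .
        then have "card X \<le> (card (insert i Q) + 2) * gam k"
          using less.hyps[OF part_lt[OF X(1)] finX[OF X(1)]] fin ij by (metis finite_Diff finite_insert)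
        also have "\<dots> \<le> (card Q + 3) * gam k"
          using fin(3) by (intro mult_le_mono1) (simp add: card_insert_if)
        finally have "card V \<le> 3 * ((card Q + 3) * gam k) + 1" using X(2) by simp
        also have "\<dots> \<le> (card Q + 2) * (5 * gam k)" using gam_pos[of k] by (simp add: algebra_simps)
        finally show ?thesis using k by simp
      qed
      show ?thesis
      proof (rule size_cases)
        assume "card V \<le> 9"
        also have "9 \<le> (card Q + 2) * (5 * gam k)" using gam_pos[of k] by (simp add: algebra_simps)
        finally show ?thesis using k by simp
      next
        fix X assume X: "X \<in> P" "card V \<le> 5 * card X" "P3_free c X r" "P3_free c X b"
        have "admissible c X (K - {r} - {b}) Q (insert b (insert r M))"
          using admissible_P3[OF admissible_P3[OF admissible_subset[OF adm part_sub[OF X(1)]] X(3)] X(4)] .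
        then have "card X \<le> (card Q + 2) * gam k"
          using less.hyps[OF part_lt[OF X(1)] finX[OF X(1)]] fin k by (metis finite_Diff)
        then have "card V \<le> (card Q + 2) * (5 * gam k)" using X(2) by simp
        then show ?thesis using k by simp
      next
        fix X assume "X \<in> P" "card V \<le> 3 * card X + 1" "P4_free c X r" "P3_free c X b"
        then show ?thesis using one[of X r b] kk by blast
      next
        fix X assume "X \<in> P" "card V \<le> 3 * card X + 1" "P4_free c X b" "P3_free c X r"
        then show ?thesis using one[of X b r] k by blast
      qed
    qed
  qed
qed

section \<open>The strict bound for an even number of kipas colours\<close>

lemma gam_even_Suc: "even n \<Longrightarrow> gam (Suc n) = 2 * gam n"
  by (auto elim!: evenE simp: gam_even gam_odd)

text \<open>With a third vertex \<open>z\<close> of \<open>B\<close>, the kipas has centre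
  \<open>x\<close> and path \<open>z\<close>, \<open>x'\<close>, \<open>y\<close>,
  \<open>y'\<close>.\<close>

lemma kipas_free_join_edges:
  assumes sym: "\<And>x y. c x y = c y x"
    and kf: "kipas_free c V i" and AB: "A \<subseteq> V" "B \<subseteq> V" "A \<inter> B = {}"
    and c: "\<And>x y. x \<in> A \<Longrightarrow> y \<in> B \<Longrightarrow> c x y = i" and "3 \<le> card B"
    and x: "x \<in> A" "x' \<in> A" "x \<noteq> x'" "c x x' = i" and y: "y \<in> B" "y' \<in> B" "y \<noteq> y'" "c y y' = i"
  shows False
proof -
  have "finite B" using assms(7) by (metis card.infinite not_numeral_le_zero)
  then have "card (B - {y, y'}) \<ge> 1" using assms(7) y by (subst card_Diff_subset) auto
  then have "B - {y, y'} \<noteq> {}" by (metis card.empty not_one_le_zero)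
  then obtain z where z: "z \<in> B" "z \<noteq> y" "z \<noteq> y'" by auto
  have "x \<notin> B" "x' \<notin> B" "x \<in> V" "x' \<in> V" "y \<in> V" "y' \<in> V" "z \<in> V" using AB x y z by auto
  moreover have "c x z = i" "c x' z = i" "c x y = i" "c x y' = i" "c x' y = i" using c x y z by simp_all
  ultimately show False
    using kipas_freeD[OF kf, of x z x' y y'] x y z sym[of z x'] by auto
qed

text \<open>From \<open>3 \<le> card X\<close> it follows that \<open>2 * card X\<close> exceeds
  \<open>card X + 2\<close>, so the red neighbourhood is the union of two parts, both as large as
  \<open>X\<close>. For a blue edge in \<open>X\<close> the swapped locale is used.\<close>

lemma (in prime_coloring) no_extremal_part:
  assumes X: "X \<in> P" "3 \<le> card X" "\<And>Y. Y \<in> P \<Longrightarrow> card Y \<le> card X" "card (nb r X) = 2 * card X"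
    and E: "\<And>Y. Y \<in> P \<Longrightarrow> card Y = card X \<Longrightarrow> \<exists>x\<in>Y. \<exists>y\<in>Y. x \<noteq> y \<and> (c x y = r \<or> c x y = b)"
    and x: "x \<in> X" "x' \<in> X" "x \<noteq> x'" "c x x' = r"
  shows False
proof (rule nb_structure[OF X(1) _ X(3)])
  fix Y Z assume Y: "Y \<in> P" and Z: "Z \<in> P" and YZ: "Y \<noteq> Z" "nb r X = Y \<union> Z"
    and cb: "\<And>y z. y \<in> Y \<Longrightarrow> z \<in> Z \<Longrightarrow> c y z = b"
  have "card (nb r X) \<le> card Y + card Z" using YZ card_Un_le by auto
  then have eq: "card Y = card X" "card Z = card X" using X(4) X(3)[OF Y] X(3)[OF Z] by auto
  have blue: "\<exists>u\<in>W. \<exists>v\<in>W. u \<noteq> v \<and> c u v = b" if W: "W \<in> P" "card W = card X" "W \<subseteq> nb r X" for W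
  proof -
    obtain u v where uv: "u \<in> W" "v \<in> W" "u \<noteq> v" "c u v = r \<or> c u v = b" using E[OF W(1,2)] by auto
    moreover have "c u v \<noteq> r"
    proof
      assume "c u v = r"
      moreover have "X \<inter> W = {}" using W(3) nb_decomposition(3)[OF X(1), of r] by auto
      moreover have "c p q = r" if "p \<in> X" "q \<in> W" for p q
        using that W(3) sym unfolding nb_def by auto
      ultimately show False
        using kipas_free_join_edges[OF sym kr part_sub[OF X(1)] part_sub[OF W(1)] _ _ _ x uv(1-3)] W(2) X(2) by simp
    qed
    ultimately show ?thesis by blast
  qed
  obtain u v where uv: "u \<in> Y" "v \<in> Y" "u \<noteq> v" "c u v = b" using blue[OF Y eq(1)] YZ by auto
  obtain w z where wz: "w \<in> Z" "z \<in> Z" "w \<noteq> z" "c w z = b" using blue[OF Z eq(2)] YZ by auto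
  show False
    using kipas_free_join_edges[OF sym kb part_sub[OF Y] part_sub[OF Z] disjoint_parts[OF Y Z YZ(1)] cb _ uv wz]
      eq X(2) by simp
qed (use X in auto)

theorem card_kipas_only_less:
  fixes c :: "'a \<Rightarrow> 'a \<Rightarrow> 'b"
  assumes sym: "\<And>x y. c x y = c y x"
    and "finite V" "finite K" "even (card K)" "admissible c V K {} {}"
  shows "card V < 2 * gam (card K)"
  using assms(2-)
proof (induction "card K" arbitrary: V K rule: less_induct)
  case less
  note fin = less.prems(1,2) and ev = less.prems(3) and adm = less.prems(4)
  have bound: "card U \<le> (card Q + 2) * gam (card K')"
    if "finite K'" "finite Q" "admissible c U K' Q M" "U \<subseteq> V" for U Q M K'
    using card_admissible_le[OF sym finite_subset[OF that(4) fin(1)] that(1-3)] .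
  show ?case
  proof (rule ccontr)
    assume "\<not> ?thesis"
    then have eq: "card V = 2 * gam (card K)" using bound[OF fin(2) _ adm] by simp
    then have V2: "2 \<le> card V" using gam_pos[of "card K"] by simp
    have "card K \<noteq> 0"
    proof
      assume "card K = 0"
      then have "K = {}" using fin by simp
      moreover obtain x y where "x \<in> V" "y \<in> V" "x \<noteq> y" using obtain2[OF V2] .
      ultimately show False using admissible_color[OF adm, of x y] by simp
    qed
    then obtain k where k: "card K = Suc (Suc k)" using ev by (metis One_nat_def odd_one old.nat.exhaust)
    have evk: "even k" using ev k by simp
    define G where "G = gam k"
    have G1: "1 \<le> G" using gam_pos G_def by simp
    \<comment> \<open>A split reaches at most \<open>4 * G + 4 * G\<close> or
      \<open>1 + 6 * G\<close> vertices. Evenness matters here: for odd \<open>k\<close> the value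
      of \<open>gam (Suc k)\<close> is \<open>5/2 * G\<close>, and the first bound would be
      \<open>10 * G\<close>.\<close>
    have V: "card V = 10 * G" and Gs: "gam (Suc k) = 2 * G" using eq k gam_even_Suc[OF evk] G_def by simp_all
    show False
    proof (cases "splittable c V")
      case True
      obtain A B i where AB: "A \<subseteq> V" "B \<subseteq> V" "A \<inter> B = {}" "1 \<le> card A" "card A \<le> card B"
        "card V = card A + card B" "\<forall>x\<in>A. \<forall>y\<in>B. c x y = i \<and> c y x = i"
        by (rule splittable_cases[OF sym fin(1) True])
      have cAB: "c x y = i" if "x \<in> A" "y \<in> B" for x y using AB(7) that by auto
      have cBA: "c x y = i" if "x \<in> B" "y \<in> A" for x y using AB(7) that by auto
      have "A \<noteq> {}" "B \<noteq> {}" using AB(4,5) by auto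
      then obtain a b where ab: "a \<in> A" "b \<in> B" by auto
      have "a \<noteq> b" "a \<in> V" "b \<in> V" using ab AB by auto
      then have i: "i \<in> K" using admissible_color[OF adm, of a b] cAB[OF ab] by auto
      then have kf: "kipas_free c V i" using adm unfolding admissible_def by auto
      have ki: "card (K - {i}) = Suc k" using i k fin by simp
      show False
      proof (cases "2 \<le> card A")
        case True
        have "P3_free c A i" "P3_free c B i"
          using kipas_free_join_P3[OF sym kf AB(2,1) _ _ cBA] kipas_free_join_P3[OF sym kf AB(1,2,3) True cAB]
            AB(3,5) True by auto
        then have "card A \<le> 2 * gam (Suc k)" "card B \<le> 2 * gam (Suc k)"
          using bound[OF _ _ admissible_P3[OF admissible_subset[OF adm AB(1)]], of i]
            bound[OF _ _ admissible_P3[OF admissible_subset[OF adm AB(2)]], of i] fin ki AB(1,2) by auto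
        then show False using AB(6) V Gs G1 by simp
      next
        case False
        have "P4_free c B i"
          using kipas_free_join_P4[OF sym kf AB(1,2,3) _ cAB] ab by auto
        then have "card B \<le> 3 * gam (Suc k)"
          using bound[OF _ _ admissible_P4[OF admissible_subset[OF adm AB(2)]], of i] fin ki AB(2) by auto
        then show False using AB(4,6) False V Gs G1 by simp
      qed
    next
      case False
      obtain P r b where gr: "gallai_reduced c V P r b"
        using gallai_partition[OF sym fin(1) V2 _ False] adm unfolding admissible_def by auto
      note pc = admissible_prime_coloring[OF gr adm]
      interpret prime_coloring c V P r b by (rule pc(1))
      interpret sw: prime_coloring c V P b r by (rule swap')
      have krb: "card (K - {r} - {b}) = k" "card (K - {b} - {r}) = k" using pc(2-4) k fin by simp_all
      \<comment> \<open>Two colours are settled by the Ramsey bound. This has to come first, since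
        for \<open>G = 1\<close> the later estimate \<open>3 * (3 * G) + 1\<close> would reach
        \<open>10 * G\<close>.\<close>
      have "k \<noteq> 0"
      proof
        assume "k = 0"
        then have "K - {r} - {b} = {}" using krb(1) fin by simp
        then have "K \<subseteq> {r, b}" by auto
        have "two_coloring c V r b"
        proof unfold_locales
          show "c x y = r \<or> c x y = b" if "x \<in> V" "y \<in> V" "x \<noteq> y" for x y
            using admissible_color[OF adm that] \<open>K \<subseteq> {r, b}\<close> by auto
        qed (rule sym finite rb kr kb)+
        then have "card V \<le> 9" by (rule two_coloring.card_le_9)
        then show False using V G1 by simp
      qed
      then have G2: "2 \<le> G"
        unfolding G_def using gam_double[of "k - 1"] gam_pos[of "k - 1"] by simp
      have one: False if X: "X \<in> P" "card V \<le> 3 * card X + 1" "P4_free c X i" "P3_free c X j"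
        and ij: "card (K - {j} - {i}) = k" for X i j
      proof -
        have "admissible c X (K - {j} - {i}) {i} {j}"
          using admissible_P4[OF admissible_P3[OF admissible_subset[OF adm part_sub[OF X(1)]] X(4)] X(3)] .
        then have "card X \<le> 3 * gam k"
          using bound[of "K - {j} - {i}" "{i}" X "{j}"] fin ij part_sub[OF X(1)] by simp
        then show False using X(2) V G2 G_def by simp
      qed
      show False
      proof (rule size_cases)
        assume "card V \<le> 9"
        then show False using V G1 by simp
      next
        fix X assume X: "X \<in> P" "2 \<le> card X" "\<And>Y. Y \<in> P \<Longrightarrow> card Y \<le> card X" "card V \<le> 5 * card X"
          "P3_free c X r" "P3_free c X b"
        have "admissible c X (K - {r} - {b}) {} {b, r}"
          using admissible_P3[OF admissible_P3[OF admissible_subset[OF adm part_sub[OF X(1)]] X(5)] X(6)] .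
        then have "card X \<le> 2 * G"
          using bound[of "K - {r} - {b}" "{}" X "{b, r}"] fin krb part_sub[OF X(1)] G_def by simp
        then have cX: "card X = 2 * G" using X(4) V by simp
        have "card (nb r X) \<le> 2 * card X" "card (nb b X) \<le> 2 * card X"
          using nb_card_le[OF X(1,2,3,2)] sw.nb_card_le[OF X(1,2,3,2)] by auto
        then have nb: "card (nb r X) = 2 * card X" "card (nb b X) = 2 * card X"
          using card_V[OF X(1)] cX V by simp_all
        \<comment> \<open>A part with neither colour would be colored by the remaining
          \<open>k\<close> kipas colours alone, and \<open>k\<close> is even, so the induction
          hypothesis makes it smaller than \<open>2 * G\<close>.\<close>
        have E: "\<exists>x\<in>Y. \<exists>y\<in>Y. x \<noteq> y \<and> (c x y = r \<or> c x y = b)" if Y: "Y \<in> P" "card Y = card X" for Y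
        proof (rule ccontr)
          assume N: "\<not> ?thesis"
          have "admissible c Y (K - {r}) {} {}"
            using admissible_unused[OF admissible_subset[OF adm part_sub[OF Y(1)]], of r] N by auto
          then have "admissible c Y (K - {r} - {b}) {} {}"
            using admissible_unused[of c Y "K - {r}" "{}" "{}" b] N by auto
          moreover have "finite Y" using part_sub[OF Y(1)] fin finite_subset by auto
          ultimately have "card Y < 2 * G"
            using less.hyps[of "K - {r} - {b}" Y] krb(1) k fin evk G_def by simp
          then show False using Y(2) cX by simp
        qed
        obtain x y where xy: "x \<in> X" "y \<in> X" "x \<noteq> y" "c x y = r \<or> c x y = b" using E[OF X(1)] by auto
        have X3: "3 \<le> card X" using cX G2 by simp
        have E': "\<exists>x\<in>Y. \<exists>y\<in>Y. x \<noteq> y \<and> (c x y = b \<or> c x y = r)" if Y: "Y \<in> P" "card Y = card X" for Y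
          using E[OF that] by blast
        from xy(4) show False
        proof
          assume red: "c x y = r"
          show False by (rule no_extremal_part[OF X(1) X3 _ nb(1) _ xy(1-3) red]) (erule X(3), rule E)
        next
          assume blue: "c x y = b"
          show False by (rule sw.no_extremal_part[OF X(1) X3 _ nb(2) _ xy(1-3) blue]) (erule X(3), rule E')
        qed
      next
        fix X assume "X \<in> P" "card V \<le> 3 * card X + 1" "P4_free c X r" "P3_free c X b"
        then show False using one[of X r b] krb by blast
      next
        fix X assume "X \<in> P" "card V \<le> 3 * card X + 1" "P4_free c X b" "P3_free c X r"
        then show False using one[of X b r] krb by blast
      qed
    qed
  qed
qed

subsection \<open>Lower bound constructions\<close>

lemma inj_on_neq: "inj_on f U \<Longrightarrow> x \<in> U \<Longrightarrow> y \<in> U \<Longrightarrow> x \<noteq> y \<Longrightarrow> f x \<noteq> f y"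
  by (simp add: inj_on_eq_iff)

lemma admissible_map:
  assumes f: "inj_on f U" "f ` U \<subseteq> V" and c': "\<And>x y. x \<in> U \<Longrightarrow> y \<in> U \<Longrightarrow> c' x y = c (f x) (f y)"
    and adm: "admissible c V K Q M"
  shows "admissible c' U K Q M"
proof -
  have fV: "f x \<in> V" if "x \<in> U" for x using f that by auto
  note ne = inj_on_neq[OF f(1)]
  have col: "c' x y \<in> K \<union> Q \<union> M" if "x \<in> U" "y \<in> U" "x \<noteq> y" for x y
    using admissible_color[OF adm fV[OF that(1)] fV[OF that(2)] ne[OF that]] c' that by simp
  have kip: "kipas_free c' U i" if kf: "kipas_free c V i" for i
    unfolding kipas_free_def
  proof (rule notI, elim exE conjE)
    fix v x y z w assume A: "{v, x, y, z, w} \<subseteq> U" "distinct [v, x, y, z, w]" and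
      e: "c' v x = i" "c' v y = i" "c' v z = i" "c' v w = i" "c' x y = i" "c' y z = i" "c' z w = i"
    then have "distinct [f v, f x, f y, f z, f w]" using f(1) by (simp add: inj_on_eq_iff)
    then show False
      using kipas_freeD[OF kf fV fV fV fV fV, of v x y z w] A(1) e c' by simp
  qed
  have p4: "P4_free c' U i" if pf: "P4_free c V i" for i
    unfolding P4_free_def
  proof (rule notI, elim exE conjE)
    fix x y z w assume A: "{x, y, z, w} \<subseteq> U" "distinct [x, y, z, w]" and
      e: "c' x y = i" "c' y z = i" "c' z w = i"
    then have "distinct [f x, f y, f z, f w]" using f(1) by (simp add: inj_on_eq_iff)
    then show False using P4_freeD[OF pf fV fV fV fV, of x y z w] A(1) e c' by simp
  qed
  have p3: "P3_free c' U i" if pf: "P3_free c V i" for i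
    unfolding P3_free_def
  proof (rule notI, elim exE conjE)
    fix x y z assume A: "{x, y, z} \<subseteq> U" "distinct [x, y, z]" and e: "c' x y = i" "c' y z = i"
    then have "distinct [f x, f y, f z]" using f(1) by (simp add: inj_on_eq_iff)
    then show False using P3_freeD[OF pf fV fV fV, of x y z] A(1) e c' by simp
  qed
  have rf: "rainbow_free c' U"
    unfolding rainbow_free_def
  proof (intro ballI impI)
    fix x y z assume A: "x \<in> U" "y \<in> U" "z \<in> U" "distinct [x, y, z]"
    then have "distinct [f x, f y, f z]" using f(1) by (simp add: inj_on_eq_iff)
    moreover have "rainbow_free c V" using adm unfolding admissible_def by simp
    ultimately show "c' x y = c' y z \<or> c' y z = c' x z \<or> c' x y = c' x z"
      using rainbow_freeD[of c V "f x" "f y" "f z"] A c' fV by simp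
  qed
  show ?thesis
    using col kip p4 p3 rf adm unfolding admissible_def by blast
qed

lemma admissible_more_P3:
  assumes adm: "admissible c V K {} M" and "M \<subseteq> M'" "M' \<inter> K = {}"
  shows "admissible c V K {} M'"
proof -
  have "P3_free c V i" if i: "i \<in> M'" for i
  proof (cases "i \<in> M")
    case True
    then show ?thesis using adm unfolding admissible_def by simp
  next
    case False
    have "c x y \<noteq> i" if "x \<in> V" "y \<in> V" "x \<noteq> y" for x y
      using admissible_color[OF adm that] False i assms(3) by auto
    then show ?thesis unfolding P3_free_def by auto
  qed
  then show ?thesis using adm assms(2) unfolding admissible_def by auto
qed

text \<open>The colour of the triangle-free class may be reused, as a matching, inside the parts indexed by
  an independent set \<open>F\<close>.\<close>

lemma substitution_kipas_free:
  assumes sym: "\<And>x y. c x y = c y x"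
    and cross: "\<And>x y. x \<in> V \<Longrightarrow> y \<in> V \<Longrightarrow> p x \<noteq> p y \<Longrightarrow> c x y = i \<Longrightarrow> R (p x) (p y)"
    and inside: "\<And>x y. x \<in> V \<Longrightarrow> y \<in> V \<Longrightarrow> p x = p y \<Longrightarrow> x \<noteq> y \<Longrightarrow> c x y = i \<Longrightarrow> p x \<in> F"
    and P3: "\<And>j. P3_free c {x \<in> V. p x = j} i"
    and tri: "\<And>u v w. R u v \<Longrightarrow> R v w \<Longrightarrow> \<not> R u w"
    and indep: "\<And>u v. u \<in> F \<Longrightarrow> v \<in> F \<Longrightarrow> \<not> R u v"
  shows "kipas_free c V i"
  unfolding kipas_free_def
proof (rule notI, elim exE conjE)
  fix v x y z w assume V: "{v, x, y, z, w} \<subseteq> V" and D: "distinct [v, x, y, z, w]"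
    and e: "c v x = i" "c v y = i" "c v z = i" "c v w = i" "c x y = i" "c y z = i" "c z w = i"
  have e': "c x v = i" "c y v = i" "c z v = i" "c w v = i" "c y x = i" "c z y = i" "c w z = i"
    using e sym by simp_all
  have path: False if "a \<in> V" "b \<in> V" "d \<in> V" "distinct [a, b, d]" "c a b = i" "c b d = i" "p a = p b" "p b = p d"
    for a b d
    using P3_freeD[OF P3, of a "p a" b d] that by simp
  \<comment> \<open>In a triangle of colour \<open>i\<close> exactly two vertices share a part:
    \<open>R\<close> has no triangle, and \<open>i\<close> is a matching inside each part.\<close>
  have tr: "(p a = p b \<and> p d \<noteq> p a) \<or> (p b = p d \<and> p a \<noteq> p b) \<or> (p a = p d \<and> p b \<noteq> p a)"
    if "a \<in> V" "b \<in> V" "d \<in> V" "distinct [a, b, d]" "c a b = i" "c b d = i" "c a d = i" for a b d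
  proof -
    have "\<not> (p a \<noteq> p b \<and> p b \<noteq> p d \<and> p a \<noteq> p d)"
      using cross[OF that(1,2) _ that(5)] cross[OF that(2,3) _ that(6)] cross[OF that(1,3) _ that(7)] tri by blast
    moreover have "\<not> (p a = p b \<and> p b = p d)" using path[OF that(1-6)] by blast
    ultimately show ?thesis by metis
  qed
  \<comment> \<open>Two parts joined in colour \<open>i\<close> cannot both contain an edge of this
    colour, as their indices would both lie in \<open>F\<close>.\<close>
  have clash: False if "a \<in> V" "a' \<in> V" "d \<in> V" "d' \<in> V" "a \<noteq> a'" "d \<noteq> d'" "p a = p a'" "p d = p d'"
      "c a a' = i" "c d d' = i" "c a d = i" "p a \<noteq> p d" for a a' d d'
    using indep[OF inside[OF that(1,2,7,5,9)] inside[OF that(3,4,8,6,10)]] cross[OF that(1,3,12,11)] by simp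
  have in_V: "v \<in> V" "x \<in> V" "y \<in> V" "z \<in> V" "w \<in> V" using V by auto
  note E = in_V e e'
  \<comment> \<open>Following which pair shares a part through the triangles \<open>v x y\<close>,
    \<open>v y z\<close>, \<open>v z w\<close> always ends in \<open>path\<close> or in
    \<open>clash\<close>.\<close>
  consider "p v = p x" "p y \<noteq> p v" | "p x = p y" "p v \<noteq> p x" | "p v = p y" "p x \<noteq> p v"
    using tr[of v x y] E D by auto
  then show False
  proof cases
    case 1
    then consider "p y = p z" | "p v = p z" using tr[of v y z] E D by auto
    then show False
    proof cases
      case 1
      then show False using clash[of v x y z] \<open>p v = p x\<close> \<open>p y \<noteq> p v\<close> E D by auto
    next
      case 2
      then show False using path[of x v z] \<open>p v = p x\<close> E D by auto
    qed
  next
    case 2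
    then consider "p y = p z" | "p v = p z" using tr[of v y z] E D by auto
    then show False
    proof cases
      case 1
      then show False using path[of x y z] \<open>p x = p y\<close> E D by auto
    next
      case 2
      then show False using clash[of v z x y] \<open>p x = p y\<close> \<open>p v \<noteq> p x\<close> E D by auto
    qed
  next
    case 3
    then have "p z \<noteq> p v" using tr[of v y z] E D by auto
    then consider "p w = p v" | "p w = p z" using tr[of v z w] E D by auto
    then show False
    proof cases
      case 1
      then show False using path[of y v w] \<open>p v = p y\<close> E D by auto
    next
      case 2
      then show False using clash[of v y z w] \<open>p v = p y\<close> \<open>p z \<noteq> p v\<close> E D by auto
    qed
  qed
qed

lemma inside_parts_free:
  assumes sym: "\<And>x y. c x y = c y x"
    and cross: "\<And>x y. x \<in> V \<Longrightarrow> y \<in> V \<Longrightarrow> p x \<noteq> p y \<Longrightarrow> c x y \<noteq> i"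
  shows "(\<And>j. kipas_free c {x \<in> V. p x = j} i) \<Longrightarrow> kipas_free c V i"
    and "(\<And>j. P3_free c {x \<in> V. p x = j} i) \<Longrightarrow> P3_free c V i"
proof -
  assume K: "\<And>j. kipas_free c {x \<in> V. p x = j} i"
  show "kipas_free c V i"
    unfolding kipas_free_def
  proof (rule notI, elim exE conjE)
    fix v x y z w assume V: "{v, x, y, z, w} \<subseteq> V" and D: "distinct [v, x, y, z, w]"
      and e: "c v x = i" "c v y = i" "c v z = i" "c v w = i" "c x y = i" "c y z = i" "c z w = i"
    have "p v = p x" "p v = p y" "p v = p z" "p v = p w" using cross[of v] V e by auto
    then show False using kipas_freeD[OF K[of "p v"], of v x y z w] V D e by auto
  qed
next
  assume K: "\<And>j. P3_free c {x \<in> V. p x = j} i"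
  show "P3_free c V i"
    unfolding P3_free_def
  proof (rule notI, elim exE conjE)
    fix x y z assume V: "{x, y, z} \<subseteq> V" and D: "distinct [x, y, z]" and e: "c x y = i" "c y z = i"
    have "p x = p y" "p y = p z" using cross[of x y] cross[of y z] V e by auto
    then show False using P3_freeD[OF K[of "p x"], of x y z] V D e by auto
  qed
qed

section \<open>Substitution into the two-coloring of five vertices\<close>

definition pentagon :: "nat \<Rightarrow> nat \<Rightarrow> bool" where
  "pentagon i j \<longleftrightarrow> (i, j) \<in> {(0, 1), (1, 2), (2, 3), (3, 4), (4, 0), (1, 0), (2, 1), (3, 2), (4, 3), (0, 4)}"

definition pentagram :: "nat \<Rightarrow> nat \<Rightarrow> bool" where
  "pentagram i j \<longleftrightarrow> (i, j) \<in> {(0, 2), (2, 4), (4, 1), (1, 3), (3, 0), (2, 0), (4, 2), (1, 4), (3, 1), (0, 3)}"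

lemma pentagon_cases:
  assumes "i < 5" "j < 5" "i \<noteq> j"
  shows "pentagon i j \<or> pentagram i j" "\<not> (pentagon i j \<and> pentagram i j)"
proof -
  have "i \<in> {0, 1, 2, 3, 4}" "j \<in> {0, 1, 2, 3, 4}" using assms by auto
  then show "pentagon i j \<or> pentagram i j" "\<not> (pentagon i j \<and> pentagram i j)"
    using assms(3) unfolding pentagon_def pentagram_def by (elim insertE emptyE; simp)+
qed

lemma pentagon_sym: "pentagon i j = pentagon j i"
  unfolding pentagon_def by auto

lemma pentagon_triangle_free: "pentagon u v \<Longrightarrow> pentagon v w \<Longrightarrow> \<not> pentagon u w"
  unfolding pentagon_def insert_iff empty_iff prod.inject by (elim disjE conjE FalseE; simp)

lemma pentagram_triangle_free: "pentagram u v \<Longrightarrow> pentagram v w \<Longrightarrow> \<not> pentagram u w"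
  unfolding pentagram_def insert_iff empty_iff prod.inject by (elim disjE conjE FalseE; simp)

text \<open>Vertices are natural numbers so that a pair of a position and a vertex can again be
  coded as a number; \<open>V\<close> is an arbitrary finite set because the coding leaves
  gaps.\<close>

definition realizable :: "'b set \<Rightarrow> 'b set \<Rightarrow> nat \<Rightarrow> bool" where
  "realizable K M N \<longleftrightarrow> (\<exists>(c :: nat \<Rightarrow> nat \<Rightarrow> 'b) V. (\<forall>x y. c x y = c y x) \<and> finite V \<and> card V = N \<and>
     admissible c V K {} M)"

lemma realizableE:
  assumes "realizable K M N"
  obtains c :: "nat \<Rightarrow> nat \<Rightarrow> 'b" and V where "\<forall>x y. c x y = c y x" "finite V" "card V = N" "admissible c V K {} M"
  using assms unfolding realizable_def by blast

text \<open>\<open>F j\<close> contains those of the two new colours that the part at position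
  \<open>j\<close> may use again as matchings. Positions sharing a colour must not be joined in it,
  which is the hypothesis \<open>indep\<close> of \<open>substitution_kipas_free\<close>.\<close>

lemma pentagon_substitution:
  fixes c :: "nat \<Rightarrow> nat \<Rightarrow> nat \<Rightarrow> 'b" and W :: "nat \<Rightarrow> nat set"
  assumes sym: "\<And>j x y. c j x y = c j y x" and fin: "\<And>j. finite (W j)"
    and adm: "\<And>j. j < 5 \<Longrightarrow> admissible (c j) (W j) K {} (M \<union> F j)"
    and F: "\<And>j. F j \<subseteq> {r, b}"
    and Fr: "\<And>i j. r \<in> F i \<Longrightarrow> r \<in> F j \<Longrightarrow> \<not> pentagon i j"
    and Fb: "\<And>i j. b \<in> F i \<Longrightarrow> b \<in> F j \<Longrightarrow> \<not> pentagram i j"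
    and rb: "r \<noteq> b" "r \<notin> K \<union> M" "b \<notin> K \<union> M"
  shows "realizable (insert r (insert b K)) M (\<Sum>j<5. card (W j))"
proof -
  \<comment> \<open>The number \<open>5 * u + j\<close> stands for the vertex \<open>u\<close> of
    the part at position \<open>j\<close>.\<close>
  define p where "p x = x mod 5" for x :: nat
  define f where "f x = x div 5" for x :: nat
  define V where "V = {x. f x \<in> W (p x)}"
  define c' where "c' x y = (if p x = p y then c (p x) (f x) (f y) else if pentagon (p x) (p y) then r else b)" for x y
  have p5: "p x < 5" for x unfolding p_def by simp
  have sym': "c' x y = c' y x" for x y
    unfolding c'_def using sym[of "p x" "f x"] pentagon_sym[of "p x"] by simp
  have V_eq: "V = (\<Union>j<5. (\<lambda>x. 5 * x + j) ` W j)"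
  proof (intro set_eqI iffI)
    fix x assume "x \<in> V"
    then have "x = 5 * f x + p x" "f x \<in> W (p x)" unfolding V_def f_def p_def by simp_all
    then show "x \<in> (\<Union>j<5. (\<lambda>x. 5 * x + j) ` W j)" using p5[of x] by blast
  next
    fix x assume "x \<in> (\<Union>j<5. (\<lambda>x. 5 * x + j) ` W j)"
    then obtain j y where "j < 5" "y \<in> W j" "x = 5 * y + j" by auto
    then show "x \<in> V" unfolding V_def f_def p_def by simp
  qed
  have finV: "finite V" unfolding V_eq using fin by simp
  have "card V = (\<Sum>j<5. card ((\<lambda>x. 5 * x + j) ` W j))"
    unfolding V_eq
  proof (rule card_UN_disjoint)
    show "\<forall>i\<in>{..<5}. \<forall>j\<in>{..<5}. i \<noteq> j \<longrightarrow> (\<lambda>x. 5 * x + i) ` W i \<inter> (\<lambda>x. 5 * x + j) ` W j = {}"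
    proof (intro ballI impI equals0I)
      fix i j x :: nat assume A: "i \<in> {..<5}" "j \<in> {..<5}" "i \<noteq> j"
        "x \<in> (\<lambda>x. 5 * x + i) ` W i \<inter> (\<lambda>x. 5 * x + j) ` W j"
      have "x mod 5 = i" using A(1,4) by (elim IntE imageE) simp
      moreover have "x mod 5 = j" using A(2,4) by (elim IntE imageE) simp
      ultimately show False using A(3) by simp
    qed
  qed (use fin in auto)
  also have "\<dots> = (\<Sum>j<5. card (W j))"
    by (intro sum.cong refl card_image) (simp add: inj_on_def)
  finally have cV: "card V = (\<Sum>j<5. card (W j))" .
  have part: "admissible c' {x \<in> V. p x = j} K {} (M \<union> F j)" if j: "j < 5" for j
  proof (rule admissible_map[OF _ _ _ adm[OF j], of f])
    show "inj_on f {x \<in> V. p x = j}"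
      unfolding inj_on_def f_def p_def by (metis (mono_tags, lifting) mem_Collect_eq mult_div_mod_eq)
    show "f ` {x \<in> V. p x = j} \<subseteq> W j" unfolding V_def by auto
    show "c' x y = c j (f x) (f y)" if "x \<in> {x \<in> V. p x = j}" "y \<in> {x \<in> V. p x = j}" for x y
      using that unfolding c'_def by simp
  qed
  have empty: "{x \<in> V. p x = j} = {}" if "\<not> j < 5" for j using p5 that by auto
  have inside: "c' x y \<in> K \<union> M \<union> F (p x)" if "x \<in> V" "y \<in> V" "p x = p y" "x \<noteq> y" for x y
    using admissible_color[OF part[OF p5[of x]], of x y] that by auto
  have rb_part: "P3_free c' {x \<in> V. p x = j} i" if i: "i \<in> {r, b}" for i j
  proof (cases "j < 5 \<and> i \<in> F j")
    case True
    then show ?thesis using part[of j] unfolding admissible_def by simp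
  next
    case False
    have "c' x y \<noteq> i" if "x \<in> V" "y \<in> V" "p x = j" "p y = j" "x \<noteq> y" for x y
      using inside[of x y] that False p5[of x] rb i by auto
    then show ?thesis unfolding P3_free_def by auto
  qed
  have kr: "kipas_free c' V r"
  proof (rule substitution_kipas_free[OF sym', where p = p and R = pentagon and F = "{j. r \<in> F j}"])
    show "pentagon (p x) (p y)" if "p x \<noteq> p y" "c' x y = r" for x y
      using that rb unfolding c'_def by (auto split: if_splits)
    show "p x \<in> {j. r \<in> F j}" if "x \<in> V" "y \<in> V" "p x = p y" "x \<noteq> y" "c' x y = r" for x y
      using inside[of x y] that rb by auto
  qed (use rb_part pentagon_triangle_free Fr in auto)
  have kb: "kipas_free c' V b"
  proof (rule substitution_kipas_free[OF sym', where p = p and R = pentagram and F = "{j. b \<in> F j}"])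
    show "pentagram (p x) (p y)" if "p x \<noteq> p y" "c' x y = b" for x y
      using that rb pentagon_cases[of "p x" "p y"] p5 unfolding c'_def by (auto split: if_splits)
    show "p x \<in> {j. b \<in> F j}" if "x \<in> V" "y \<in> V" "p x = p y" "x \<noteq> y" "c' x y = b" for x y
      using inside[of x y] that rb by auto
  qed (use rb_part pentagram_triangle_free Fb in auto)
  have cross: "c' x y \<in> {r, b}" if "p x \<noteq> p y" for x y using that unfolding c'_def by simp
  have kK: "kipas_free c' V i" if i: "i \<in> K" for i
  proof (rule inside_parts_free(1)[OF sym', where p = p])
    show "c' x y \<noteq> i" if "p x \<noteq> p y" for x y using cross[OF that] i rb by auto
    show "kipas_free c' {x \<in> V. p x = j} i" for j
      using part[of j] empty[of j] i unfolding admissible_def by (cases "j < 5") (auto simp: kipas_free_def)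
  qed
  have pM: "P3_free c' V i" if i: "i \<in> M" for i
  proof (rule inside_parts_free(2)[OF sym', where p = p])
    show "c' x y \<noteq> i" if "p x \<noteq> p y" for x y using cross[OF that] i rb by auto
    show "P3_free c' {x \<in> V. p x = j} i" for j
      using part[of j] empty[of j] i unfolding admissible_def by (cases "j < 5") (auto simp: P3_free_def)
  qed
  \<comment> \<open>Edges between parts depend only on the positions and have two colours, so a
    rainbow triangle would lie inside one part.\<close>
  have rf: "rainbow_free c' V"
    unfolding rainbow_free_def
  proof (intro ballI impI)
    fix x y z assume V: "x \<in> V" "y \<in> V" "z \<in> V" "distinct [x, y, z]"
    show "c' x y = c' y z \<or> c' y z = c' x z \<or> c' x y = c' x z"
    proof (cases "p x = p y \<and> p y = p z")
      case True
      then show ?thesis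
        using part[OF p5[of x]] rainbow_freeD[of c' "{u \<in> V. p u = p x}" x y z] V unfolding admissible_def by auto
    next
      case False
      then consider "p x = p y" "p z \<noteq> p x" | "p y = p z" "p x \<noteq> p y" | "p x = p z" "p x \<noteq> p y"
        | "p x \<noteq> p y" "p y \<noteq> p z" "p x \<noteq> p z" by metis
      then show ?thesis
      proof cases
        case 3
        then show ?thesis using pentagon_sym[of "p x" "p y"] unfolding c'_def by simp
      next
        case 4
        then show ?thesis using cross[of x y] cross[of y z] cross[of x z] by auto
      qed (simp_all add: c'_def)
    qed
  qed
  have "c' x y \<in> insert r (insert b K) \<union> {} \<union> M" if "x \<in> V" "y \<in> V" "x \<noteq> y" for x y
    using inside[of x y] cross[of x y] F[of "p x"] that by (cases "p x = p y") auto
  then have "admissible c' V (insert r (insert b K)) {} M"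
    unfolding admissible_def using kr kb kK pM rf by auto
  then show ?thesis using sym' finV cV unfolding realizable_def by blast
qed

lemma card_two_more:
  assumes "card K = Suc (Suc n)"
  obtains r b K' where "K = insert r (insert b K')" "r \<noteq> b" "r \<notin> K'" "b \<notin> K'" "card K' = n"
  using assms by (auto simp: card_Suc_eq)

lemma realizable_pentagon:
  fixes K M :: "'b set"
  assumes "realizable K M N" and "r \<noteq> b" "r \<notin> K \<union> M" "b \<notin> K \<union> M"
  shows "realizable (insert r (insert b K)) M (5 * N)"
proof -
  obtain c :: "nat \<Rightarrow> nat \<Rightarrow> 'b" and V where c: "\<forall>x y. c x y = c y x" "finite V" "card V = N" "admissible c V K {} M"
    by (rule realizableE[OF assms(1)])
  have "realizable (insert r (insert b K)) M (\<Sum>j<5::nat. card V)"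
    by (rule pentagon_substitution[of "\<lambda>_. c" "\<lambda>_. V" K M "\<lambda>_. {}" r b]) (use c assms in auto)
  then show ?thesis using c(3) by simp
qed

text \<open>The start is a single edge of colour \<open>\<mu>\<close>; each two further kipas
  colours multiply by 5.\<close>

lemma realizable_even:
  assumes "card K = 2 * m" "finite K" "\<mu> \<notin> K"
  shows "realizable K {\<mu>} (2 * 5 ^ m)"
  using assms
proof (induction m arbitrary: K)
  case 0
  have "admissible (\<lambda>_ _. \<mu>) {0, 1 :: nat} {} {} {\<mu>}"
    unfolding admissible_def P3_free_def rainbow_free_def by auto
  then show ?case
    unfolding realizable_def using 0 by (intro exI[of _ "\<lambda>_ _. \<mu>"] exI[of _ "{0, 1}"]) simp
next
  case (Suc m)
  obtain r b K' where K: "K = insert r (insert b K')" "r \<noteq> b" "r \<notin> K'" "b \<notin> K'" "card K' = 2 * m"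
    using card_two_more[of K "2 * m"] Suc.prems(1) by auto
  then have "realizable K' {\<mu>} (2 * 5 ^ m)" using Suc by auto
  then show ?case using realizable_pentagon[of K' "{\<mu>}" "2 * 5 ^ m" r b] K Suc.prems by auto
qed

text \<open>The start is a monochromatic complete graph on 4 vertices, one too few for a
  kipas.\<close>

lemma realizable_odd:
  assumes "card K = Suc (2 * m)"
  shows "realizable K {} (4 * 5 ^ m)"
  using assms
proof (induction m arbitrary: K)
  case 0
  then obtain i where i: "K = {i}" by (auto simp: card_Suc_eq)
  have "kipas_free (\<lambda>_ _. i) {..<4 :: nat} i"
    unfolding kipas_free_def
  proof (rule notI, elim exE conjE)
    fix v x y z w :: nat assume A: "{v, x, y, z, w} \<subseteq> {..<4}" "distinct [v, x, y, z, w]"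
    then have "card {v, x, y, z, w} \<le> 4" using card_mono[OF _ A(1)] by simp
    then show False using A(2) by simp
  qed
  then have "admissible (\<lambda>_ _. i) {..<4 :: nat} K {} {}"
    unfolding admissible_def rainbow_free_def i by auto
  then show ?case
    unfolding realizable_def by (intro exI[of _ "\<lambda>_ _. i"] exI[of _ "{..<4}"]) simp
next
  case (Suc m)
  obtain r b K' where K: "K = insert r (insert b K')" "r \<noteq> b" "r \<notin> K'" "b \<notin> K'" "card K' = Suc (2 * m)"
    using card_two_more[of K "Suc (2 * m)"] Suc.prems(1) by auto
  then have "realizable K' {} (4 * 5 ^ m)" using Suc by auto
  then show ?case using realizable_pentagon[of K' "{}" "4 * 5 ^ m" r b] K by auto
qed

text \<open>The parts at the non-adjacent positions 0, 2 of the pentagon may contain a matching in its colour \<open>r\<close>,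
  and those at the positions 3, 4, not adjacent in the pentagram, one in \<open>b\<close>.\<close>

lemma realizable_kipas_only:
  fixes K :: "'b set"
  assumes "card K = 2 * m" "finite K"
  shows "realizable K {} (2 * 5 ^ m - 1)"
  using assms
proof (induction m arbitrary: K)
  case 0
  \<comment> \<open>Since \<open>2 * 5 ^ 0 - 1 = 1\<close>, there is one vertex and no edge to
    color.\<close>
  have "admissible (\<lambda>_ _. undefined) {0 :: nat} K {} {}"
    using 0 unfolding admissible_def rainbow_free_def by auto
  then show ?case
    unfolding realizable_def by (intro exI[of _ "\<lambda>_ _. undefined"] exI[of _ "{0}"]) simp
next
  case (Suc m)
  obtain r b K' where K: "K = insert r (insert b K')" "r \<noteq> b" "r \<notin> K'" "b \<notin> K'" "card K' = 2 * m"
    using card_two_more[of K "2 * m"] Suc.prems(1) by auto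
  have fin: "finite K'" using K Suc.prems by auto
  obtain cr :: "nat \<Rightarrow> nat \<Rightarrow> 'b" and Vr where R: "\<forall>x y. cr x y = cr y x" "finite Vr" "card Vr = 2 * 5 ^ m" "admissible cr Vr K' {} {r}"
    by (rule realizableE[OF realizable_even[OF K(5) fin K(3)]])
  obtain cb :: "nat \<Rightarrow> nat \<Rightarrow> 'b" and Vb where B: "\<forall>x y. cb x y = cb y x" "finite Vb" "card Vb = 2 * 5 ^ m" "admissible cb Vb K' {} {b}"
    by (rule realizableE[OF realizable_even[OF K(5) fin K(4)]])
  obtain c0 :: "nat \<Rightarrow> nat \<Rightarrow> 'b" and V0 where Z: "\<forall>x y. c0 x y = c0 y x" "finite V0" "card V0 = 2 * 5 ^ m - 1" "admissible c0 V0 K' {} {}"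
    by (rule realizableE[OF Suc.IH[OF K(5) fin]])
  define c where "c j = (if j \<in> {0, 2} then cr else if j \<in> {3, 4} then cb else c0)" for j :: nat
  define W where "W j = (if j \<in> {0, 2} then Vr else if j \<in> {3, 4} then Vb else V0)" for j :: nat
  define F where "F j = (if j \<in> {0, 2} then {r} else if j \<in> {3, 4} then {b} else {})" for j :: nat
  have Fr: "\<not> pentagon i j" if "r \<in> F i" "r \<in> F j" for i j
    using that K(2) unfolding F_def pentagon_def by (auto split: if_splits)
  have Fb: "\<not> pentagram i j" if "b \<in> F i" "b \<in> F j" for i j
    using that K(2) unfolding F_def pentagram_def by (auto split: if_splits)
  have 1: "c j x y = c j y x" for j x y unfolding c_def using R(1) B(1) Z(1) by simp
  have 2: "finite (W j)" for j unfolding W_def using R B Z by simp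
  have 3: "admissible (c j) (W j) K' {} ({} \<union> F j)" for j unfolding c_def W_def F_def using R B Z by simp
  have 4: "F j \<subseteq> {r, b}" for j unfolding F_def by simp
  have "realizable (insert r (insert b K')) {} (\<Sum>j<5. card (W j))"
    by (rule pentagon_substitution[of c W K' "{}" F r b, OF 1 2 3 4 Fr Fb]) (use K in auto)
  \<comment> \<open>Four parts have \<open>2 * 5 ^ m\<close> vertices; the one at position 1 has one
    less.\<close>
  moreover have "(\<Sum>j<5::nat. card (W j)) = 2 * 5 ^ Suc m - 1"
    using R(3) B(3) Z(3) by (simp add: W_def eval_nat_numeral)
  ultimately show ?case unfolding K(1) by simp
qed

lemma realizable_more_P3:
  fixes K :: "'b set"
  assumes "realizable K M N" "M \<subseteq> M'" "M' \<inter> K = {}"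
  shows "realizable K M' N"
proof -
  obtain c :: "nat \<Rightarrow> nat \<Rightarrow> 'b" and V where "\<forall>x y. c x y = c y x" "finite V" "card V = N" "admissible c V K {} M"
    by (rule realizableE[OF assms(1)])
  then show ?thesis
    using admissible_more_P3[OF _ assms(2,3)] unfolding realizable_def by blast
qed

subsection \<open>Copies of graphs and the Gallai--Ramsey number\<close>

text \<open>The inverse of the isomorphism embeds \<open>H\<close>, and conversely the image of an
  embedding is a subgraph isomorphic to \<open>H\<close>. This replaces subgraphs by tuples of
  vertices.\<close>

lemma mono_copy_iff:
  assumes H: "simple_graph H"
  shows "mono_copy n c i H \<longleftrightarrow>
    (\<exists>g. inj_on g (verts H) \<and> g ` verts H \<subseteq> {..<n} \<and> (\<forall>e\<in>edges H. c (g ` e) = i))"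
proof
  assume "mono_copy n c i H"
  then obtain S f where S: "subgraph S (complete_graph n)" and f: "bij_betw f (verts S) (verts H)"
    and fe: "\<And>u v. u \<in> verts S \<Longrightarrow> v \<in> verts S \<Longrightarrow> {u, v} \<in> edges S \<longleftrightarrow> {f u, f v} \<in> edges H"
    and col: "\<And>e. e \<in> edges S \<Longrightarrow> c e = i"
    unfolding mono_copy_def graph_iso_def by blast
  define g where "g = inv_into (verts S) f"
  have g: "bij_betw g (verts H) (verts S)" unfolding g_def using f by (rule bij_betw_inv_into)
  have "c (g ` e) = i" if e: "e \<in> edges H" for e
  proof -
    obtain u v where uv: "e = {u, v}" "u \<in> verts H" "v \<in> verts H"
      using H e unfolding simple_graph_def card_2_iff by fastforce
    have "g u \<in> verts S" "g v \<in> verts S" using g uv bij_betwE by blast+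
    moreover have "f (g u) = u" "f (g v) = v"
      unfolding g_def using f uv by (simp_all add: bij_betw_inv_into_right)
    ultimately show ?thesis using fe[of "g u" "g v"] uv e col by simp
  qed
  moreover have "g ` verts H \<subseteq> {..<n}"
    using g S unfolding subgraph_def complete_graph_def bij_betw_def by simp
  ultimately show "\<exists>g. inj_on g (verts H) \<and> g ` verts H \<subseteq> {..<n} \<and> (\<forall>e\<in>edges H. c (g ` e) = i)"
    using g unfolding bij_betw_def by blast
next
  assume "\<exists>g. inj_on g (verts H) \<and> g ` verts H \<subseteq> {..<n} \<and> (\<forall>e\<in>edges H. c (g ` e) = i)"
  then obtain g where g: "inj_on g (verts H)" "g ` verts H \<subseteq> {..<n}" "\<forall>e\<in>edges H. c (g ` e) = i" by blast
  define S where "S = (g ` verts H, (`) g ` edges H)"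
  have eH: "e \<subseteq> verts H" "card e = 2" if "e \<in> edges H" for e using H that unfolding simple_graph_def by auto
  have card: "card (g ` e) = 2" if "e \<in> edges H" for e
    using eH[OF that] card_image[OF inj_on_subset[OF g(1)]] by simp
  have "simple_graph S"
    using H card eH(1) unfolding simple_graph_def S_def by auto
  then have "subgraph S (complete_graph n)"
    unfolding subgraph_def complete_graph_def using g(2) eH(1) card by (auto simp: S_def)
  moreover have "graph_iso S H"
    unfolding graph_iso_def
  proof (intro exI conjI ballI)
    show "bij_betw (inv_into (verts H) g) (verts S) (verts H)"
      unfolding S_def using bij_betw_inv_into[OF inj_on_imp_bij_betw[OF g(1)]] by simp
    fix u v assume "u \<in> verts S" "v \<in> verts S"
    then obtain x y where x: "u = g x" "x \<in> verts H" "v = g y" "y \<in> verts H" unfolding S_def by auto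
    have "g ` {x, y} \<in> (`) g ` edges H \<longleftrightarrow> {x, y} \<in> edges H"
    proof
      assume "g ` {x, y} \<in> (`) g ` edges H"
      then obtain e where "e \<in> edges H" "g ` {x, y} = g ` e" by auto
      then show "{x, y} \<in> edges H"
        using inj_on_image_eq_iff[OF g(1), of "{x, y}" e] x eH by auto
    qed (rule imageI)
    then show "{u, v} \<in> edges S \<longleftrightarrow> {inv_into (verts H) g u, inv_into (verts H) g v} \<in> edges H"
      using x g(1) by (simp add: S_def)
  qed
  moreover have "\<forall>e\<in>edges S. c e = i" using g(3) unfolding S_def by auto
  ultimately show "mono_copy n c i H" unfolding mono_copy_def by blast
qed

lemma path_graph_3: "path_graph 3 = ({0, 1, 2}, {{0, 1}, {1, 2}})"
proof -
  have "{..<3} = {0, 1, 2 :: nat}" by auto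
  moreover have "{{i, Suc i} | i. Suc i < 3} = {{0, 1}, {1, 2 :: nat}}"
    by (auto simp: less_Suc_eq numeral_3_eq_3 numeral_2_eq_2)
  ultimately show ?thesis unfolding path_graph_def by simp
qed

lemma path_graph_4: "path_graph 4 = ({0, 1, 2, 3}, {{0, 1}, {1, 2}, {2, 3}})"
proof -
  have "{..<4} = {0, 1, 2, 3 :: nat}" by auto
  moreover have "{{i, Suc i} | i. Suc i < 4} = {{0, 1}, {1, 2}, {2, 3 :: nat}}"
    by (auto simp: less_Suc_eq numeral_3_eq_3 numeral_2_eq_2 eval_nat_numeral)
  ultimately show ?thesis unfolding path_graph_def by simp
qed

lemma kipas4_eq: "kipas4 = ({Inl 0, Inr 0, Inr 1, Inr 2, Inr 3},
  {{Inr 0, Inr 1}, {Inr 1, Inr 2}, {Inr 2, Inr 3}, {Inl 0, Inr 0}, {Inl 0, Inr 1}, {Inl 0, Inr 2}, {Inl 0, Inr 3}})"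
proof -
  have "complete_graph 1 = ({0}, {})"
  proof -
    have "card e \<noteq> 2" if "e \<subseteq> {0 :: nat}" for e using card_mono[OF _ that] by auto
    moreover have "{..<1} = {0 :: nat}" by auto
    ultimately show ?thesis unfolding complete_graph_def by auto
  qed
  then show ?thesis
    unfolding kipas4_def join_graph_def path_graph_4 by auto
qed

lemma mono_copy_path: "mono_copy n c i (path_graph 3) \<longleftrightarrow> \<not> P3_free (\<lambda>x y. c {x, y}) {..<n} i"
proof -
  have "simple_graph (path_graph 3)" unfolding path_graph_3 simple_graph_def by auto
  note * = mono_copy_iff[OF this, of n c i]
  show ?thesis
  proof
    assume "mono_copy n c i (path_graph 3)"
    then obtain g where g: "inj_on g {0, 1, 2 :: nat}" "g ` {0, 1, 2} \<subseteq> {..<n}" "c (g ` {0, 1}) = i" "c (g ` {1, 2}) = i"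
      unfolding * unfolding path_graph_3 by auto
    then show "\<not> P3_free (\<lambda>x y. c {x, y}) {..<n} i"
      using P3_freeD[of "\<lambda>x y. c {x, y}" "{..<n}" i "g 0" "g 1" "g 2"] by (auto simp: inj_on_def)
  next
    assume "\<not> P3_free (\<lambda>x y. c {x, y}) {..<n} i"
    then obtain x y z where x: "{x, y, z} \<subseteq> {..<n}" "distinct [x, y, z]" "c {x, y} = i" "c {y, z} = i"
      unfolding P3_free_def by auto
    define g where "g j = [x, y, z] ! j" for j
    have "inj_on g {0, 1, 2}" "g ` {0, 1, 2} \<subseteq> {..<n}" "c (g ` {0, 1}) = i" "c (g ` {1, 2}) = i"
      using x unfolding g_def inj_on_def by auto
    then show "mono_copy n c i (path_graph 3)"
      unfolding * unfolding path_graph_3 by (intro exI[of _ g]) auto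
  qed
qed

lemma mono_copy_kipas: "mono_copy n c i kipas4 \<longleftrightarrow> \<not> kipas_free (\<lambda>x y. c {x, y}) {..<n} i"
proof -
  have "simple_graph kipas4" unfolding kipas4_eq simple_graph_def by auto
  note * = mono_copy_iff[OF this, of n c i]
  show ?thesis
  proof
    assume "mono_copy n c i kipas4"
    then obtain g where g: "inj_on g (verts kipas4)" "g ` verts kipas4 \<subseteq> {..<n}" "\<forall>e\<in>edges kipas4. c (g ` e) = i"
      unfolding * by auto
    have "distinct [g (Inl 0), g (Inr 0), g (Inr 1), g (Inr 2), g (Inr 3)]"
      using g(1) unfolding kipas4_eq inj_on_def by auto
    moreover have "\<forall>j\<in>{Inl 0, Inr 0, Inr 1, Inr 2, Inr 3}. g j \<in> {..<n}" using g(2) unfolding kipas4_eq by auto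
    ultimately show "\<not> kipas_free (\<lambda>x y. c {x, y}) {..<n} i"
      using kipas_freeD[of "\<lambda>x y. c {x, y}" "{..<n}" i "g (Inl 0)" "g (Inr 0)" "g (Inr 1)" "g (Inr 2)" "g (Inr 3)"]
        g(3) unfolding kipas4_eq by auto
  next
    assume "\<not> kipas_free (\<lambda>x y. c {x, y}) {..<n} i"
    then obtain v x y z w where V: "{v, x, y, z, w} \<subseteq> {..<n}" and D: "distinct [v, x, y, z, w]"
      and e: "c {v, x} = i" "c {v, y} = i" "c {v, z} = i" "c {v, w} = i" "c {x, y} = i" "c {y, z} = i" "c {z, w} = i"
      unfolding kipas_free_def by auto
    define g where "g = case_sum (\<lambda>_ :: nat. v) (\<lambda>j. [x, y, z, w] ! j)"
    have "inj_on g (verts kipas4)" using D unfolding kipas4_eq g_def inj_on_def by auto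
    moreover have "g ` verts kipas4 \<subseteq> {..<n}" using V unfolding kipas4_eq g_def by simp
    moreover have "\<forall>e\<in>edges kipas4. c (g ` e) = i" using e unfolding kipas4_eq g_def by simp
    ultimately show "mono_copy n c i kipas4" unfolding * by blast
  qed
qed

text \<open>The counterexamples to the Ramsey property are the admissible colorings with
  \<open>Q\<close> empty; \<open>s \<le> k\<close> makes the two intervals of colours cover exactly
  \<open>{1..k}\<close>.\<close>

lemma gallai_avoiding_iff:
  assumes "s \<le> k"
  shows "gallai_coloring k n c \<and> \<not> ((\<exists>i\<in>{1..s}. mono_copy n c i kipas4) \<or> (\<exists>j\<in>{s+1..k}. mono_copy n c j (path_graph 3)))
    \<longleftrightarrow> admissible (\<lambda>x y. c {x, y}) {..<n} {1..s} {} {s+1..k}"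
proof -
  have col: "c \<in> edges (complete_graph n) \<rightarrow> {1..k} \<longleftrightarrow>
      (\<forall>x\<in>{..<n}. \<forall>y\<in>{..<n}. x \<noteq> y \<longrightarrow> c {x, y} \<in> {1..s} \<union> {} \<union> {s+1..k})"
    (is "?A \<longleftrightarrow> ?B")
  proof -
    have k: "{1..s} \<union> {} \<union> {s+1..k} = {1..k}" using assms by auto
    show ?thesis
      unfolding k complete_graph_def
    proof
      assume A: "c \<in> edges ({..<n}, {e. e \<subseteq> {..<n} \<and> card e = 2}) \<rightarrow> {1..k}"
      show "\<forall>x\<in>{..<n}. \<forall>y\<in>{..<n}. x \<noteq> y \<longrightarrow> c {x, y} \<in> {1..k}"
      proof (intro ballI impI)
        fix x y assume "x \<in> {..<n}" "y \<in> {..<n}" "x \<noteq> y"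
        then show "c {x, y} \<in> {1..k}" using A by (intro funcset_mem[OF A]) auto
      qed
    next
      assume B: "\<forall>x\<in>{..<n}. \<forall>y\<in>{..<n}. x \<noteq> y \<longrightarrow> c {x, y} \<in> {1..k}"
      show "c \<in> edges ({..<n}, {e. e \<subseteq> {..<n} \<and> card e = 2}) \<rightarrow> {1..k}"
      proof
        fix e assume "e \<in> edges ({..<n}, {e. e \<subseteq> {..<n} \<and> card e = 2})"
        then obtain x y where "e = {x, y}" "x \<noteq> y" "x \<in> {..<n}" "y \<in> {..<n}"
          unfolding card_2_iff by fastforce
        then show "c e \<in> {1..k}" using B by blast
      qed
    qed
  qed
  have rain: "\<not> (\<exists>x\<in>verts (complete_graph n). \<exists>y\<in>verts (complete_graph n). \<exists>z\<in>verts (complete_graph n).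
          x \<noteq> y \<and> y \<noteq> z \<and> x \<noteq> z \<and>
          c {x, y} \<noteq> c {y, z} \<and> c {y, z} \<noteq> c {x, z} \<and> c {x, y} \<noteq> c {x, z})
      \<longleftrightarrow> rainbow_free (\<lambda>x y. c {x, y}) {..<n}"
    unfolding complete_graph_def rainbow_free_def by simp blast
  show ?thesis
    unfolding gallai_coloring_def rain col admissible_def mono_copy_kipas mono_copy_path by simp blast
qed

lemma realizable_imp_gallai:
  fixes s k :: nat
  assumes "realizable {1..s} {s+1..k} N" "n \<le> N"
  obtains e where "admissible (\<lambda>x y. e {x, y}) {..<n} {1..s} {} {s+1..k}"
proof -
  obtain c :: "nat \<Rightarrow> nat \<Rightarrow> nat" and V where c: "\<forall>x y. c x y = c y x" "finite V" "card V = N"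
    "admissible c V {1..s} {} {s+1..k}"
    by (rule realizableE[OF assms(1)])
  obtain f where f: "f ` {..<n} \<subseteq> V" "inj_on f {..<n}"
    using card_le_inj[of "{..<n}" V] c(2,3) assms(2) by auto
  \<comment> \<open>\<open>Min\<close> and \<open>Max\<close> recover the two ends of an edge from
    the set, and by symmetry of \<open>c\<close> their order does not matter.\<close>
  define e where "e E = c (f (Min E)) (f (Max E))" for E
  have "e {x, y} = c (f x) (f y)" for x y
    unfolding e_def using c(1) by (cases x y rule: linorder_cases) auto
  then have "admissible (\<lambda>x y. e {x, y}) {..<n} {1..s} {} {s+1..k}"
    by (intro admissible_map[OF f(2,1) _ c(4)])
  then show thesis by (rule that)
qed

text \<open>A realization on \<open>N\<close> vertices restricts to every smaller number, so no
  \<open>n \<le> N\<close> has the Ramsey property.\<close>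

lemma GR_eq:
  assumes "s \<le> k" "realizable {1..s} {s+1..k} N"
    and upper: "\<And>c. admissible (\<lambda>x y. c {x, y}) {..<Suc N} {1..s} {} {s+1..k} \<Longrightarrow> False"
  shows "GR k s = Suc N"
  unfolding GR_def
proof (rule cInf_eq_minimum)
  show "Suc N \<in> {n. \<forall>c. gallai_coloring k n c \<longrightarrow>
       (\<exists>i\<in>{1..s}. mono_copy n c i kipas4) \<or> (\<exists>j\<in>{s+1..k}. mono_copy n c j (path_graph 3))}"
    using gallai_avoiding_iff[OF assms(1), of "Suc N"] upper by blast
  fix n assume n: "n \<in> {n. \<forall>c. gallai_coloring k n c \<longrightarrow>
       (\<exists>i\<in>{1..s}. mono_copy n c i kipas4) \<or> (\<exists>j\<in>{s+1..k}. mono_copy n c j (path_graph 3))}"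
  show "Suc N \<le> n"
  proof (rule ccontr)
    assume "\<not> Suc N \<le> n"
    then have "n \<le> N" by simp
    then obtain e where "admissible (\<lambda>x y. e {x, y}) {..<n} {1..s} {} {s+1..k}"
      by (rule realizable_imp_gallai[OF assms(2)])
    then show False using gallai_avoiding_iff[OF assms(1), of n e] n by blast
  qed
qed

theorem theorem1p6:
  fixes k s :: nat
  assumes "k \<ge> 1" and "s \<le> k"
  shows "(even s \<and> s < k \<longrightarrow> GR k s = 2 * 5 ^ (s div 2) + 1) \<and>
         (even s \<and> s = k \<longrightarrow> GR k s = 2 * 5 ^ (s div 2)) \<and>
         (odd s \<longrightarrow> GR k s = 4 * 5 ^ ((s - 1) div 2) + 1)"
proof -
  have upper: "n \<le> 2 * gam s" if "admissible (\<lambda>x y. c {x, y}) {..<n} {1..s} {} {s+1..k}" for c :: "nat set \<Rightarrow> nat" and n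
    using card_admissible_le[OF _ _ _ _ that] by (simp add: insert_commute)
  have disj: "{s+1..k} \<inter> {1..s} = {}" by auto
  have "GR k s = 2 * 5 ^ (s div 2) + 1" if s: "even s" "s < k"
  proof -
    \<comment> \<open>The colour \<open>s + 1\<close> of the starting edge is available because
      \<open>s < k\<close>.\<close>
    have "realizable {1..s} {s + 1} (2 * 5 ^ (s div 2))"
      using s by (intro realizable_even) auto
    then have "realizable {1..s} {s+1..k} (2 * 5 ^ (s div 2))"
      using realizable_more_P3[OF _ _ disj, of "{s + 1}"] s by auto
    moreover have "gam s = 5 ^ (s div 2)" using s gam_even[of "s div 2"] by simp
    ultimately show ?thesis
      using GR_eq[OF assms(2), of "2 * 5 ^ (s div 2)"] upper[of _ "Suc (2 * gam s)"] by fastforce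
  qed
  moreover have "GR k s = 2 * 5 ^ (s div 2)" if s: "even s" "s = k"
  proof -
    have "realizable {1..s} {} (2 * 5 ^ (s div 2) - 1)"
      using s by (intro realizable_kipas_only) auto
    then have R: "realizable {1..s} {s+1..k} (2 * 5 ^ (s div 2) - 1)"
      using s by simp
    have g: "gam s = 5 ^ (s div 2)" using s gam_even[of "s div 2"] by simp
    have N: "Suc (2 * 5 ^ (s div 2) - 1) = 2 * gam s" using g gam_pos[of s] by simp
    have "GR k s = Suc (2 * 5 ^ (s div 2) - 1)"
    proof (rule GR_eq[OF assms(2) R])
      fix c :: "nat set \<Rightarrow> nat"
      assume "admissible (\<lambda>x y. c {x, y}) {..<Suc (2 * 5 ^ (s div 2) - 1)} {1..s} {} {s+1..k}"
      then have "admissible (\<lambda>x y. c {x, y}) {..<2 * gam s} {1..s} {} {}" using s unfolding N by simp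
      then have "card {..<2 * gam s} < 2 * gam (card {1..s})"
        using s by (intro card_kipas_only_less) (auto simp: insert_commute)
      then show False by simp
    qed
    then show ?thesis using N g by simp
  qed
  moreover have "GR k s = 4 * 5 ^ ((s - 1) div 2) + 1" if s: "odd s"
  proof -
    obtain m where m: "s = Suc (2 * m)" using s by (auto elim: oddE)
    \<comment> \<open>This uses kipas colours only and therefore serves \<open>s = k\<close> and
      \<open>s < k\<close> alike.\<close>
    have "realizable {1..s} {} (4 * 5 ^ m)"
      using m by (intro realizable_odd) auto
    then have "realizable {1..s} {s+1..k} (4 * 5 ^ m)"
      using realizable_more_P3[OF _ _ disj, of "{}"] by auto
    moreover have "2 * gam s = 4 * 5 ^ m" using m gam_odd by simp
    ultimately show ?thesis
      using GR_eq[OF assms(2), of "4 * 5 ^ m"] upper[of _ "Suc (2 * gam s)"] m by fastforce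
  qed
  ultimately show ?thesis by blast
qed

end
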